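(* Let $T$ be a countable Dedekind domain such that $T/J$ is finite for every nonzero proper ideal $J\subset T$, equipped with the discrete $\sigma$-algebra. Let $\mathcal{I}$ be the set of all nonzero ideals $I$ of $T$ such that $T/I$ is an elementary abelian group, and let $\epsilon\in\mathbb{R}_{>0}^{\mathcal{I}}$. Let $P=\{\mathfrak{p}_1,\dots,\mathfrak{p}_k\}$ be a finite set of nonzero prime ideals of $T$ and let $T_{\mathfrak{p}_i}=\varprojlim_m T/\mathfrak{p}_i^m$. Let $u$ be a positive integer and, for each $n$, let $M(n)$ be an $\epsilon$-balanced $n\times(n+u)$ random matrix with entries in $T$. Then \[\lim_{n\to\infty}\mathbb{P}\left(\mathrm{cok}(M(n))\otimes \prod_{i=1}^kT_{\mathfrak{p}_i}\ \text{is finite}\right)=1.\]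
   Context: An abelian group is elementary abelian if it is isomorphic to $(\mathbb{Z}/p\mathbb{Z})^m$ for some prime $p$ and integer $m>0$. If $V$ is an $\mathbb{F}_p$-vector space, a random variable $y$ in $V$ is $\epsilon'$-balanced if $\mathbb{P}(y\in H)\leq 1-\epsilon'$ for every proper affine $\mathbb{F}_p$-subspace $H\subset V$. A random variable $y$ valued in $T$ is $\epsilon$-balanced (with $\epsilon=(\epsilon_I)_{I\in\mathcal{I}}$) if for every $I\in\mathcal{I}$ the image of $y$ in $T/I$ is $\epsilon_I$-balanced. A random matrix with entries in $T$ is $\epsilon$-balanced if its entries are independent and each is $\epsilon$-balanced. $\mathrm{cok}(M)=T^n/M(T^{n+u})$. *)

theory Defs
  imports "HOL-Probability.Probability" "HOL-Computational_Algebra.Primes"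
begin

definition is_ideal :: "'a::comm_ring_1 set \<Rightarrow> bool" where
  "is_ideal I \<longleftrightarrow> 0 \<in> I \<and> (\<forall>x\<in>I. \<forall>y\<in>I. x + y \<in> I) \<and> (\<forall>x\<in>I. - x \<in> I)
      \<and> (\<forall>r. \<forall>x\<in>I. r * x \<in> I)"

definition is_prime_ideal :: "'a::comm_ring_1 set \<Rightarrow> bool" where
  "is_prime_ideal p \<longleftrightarrow> is_ideal p \<and> p \<noteq> UNIV \<and> (\<forall>a b. a * b \<in> p \<longrightarrow> a \<in> p \<or> b \<in> p)"

definition is_maximal_ideal :: "'a::comm_ring_1 set \<Rightarrow> bool" where
  "is_maximal_ideal p \<longleftrightarrow> is_ideal p \<and> p \<noteq> UNIV \<and>
      (\<forall>J. is_ideal J \<and> p \<subseteq> J \<longrightarrow> J = p \<or> J = UNIV)"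

definition ideal_gen :: "'a::comm_ring_1 set \<Rightarrow> 'a set" where
  "ideal_gen S = \<Inter> {I. is_ideal I \<and> S \<subseteq> I}"

fun ideal_pow :: "'a::comm_ring_1 set \<Rightarrow> nat \<Rightarrow> 'a set" where
  "ideal_pow p 0 = UNIV"
| "ideal_pow p (Suc m) = ideal_gen {a * b | a b. a \<in> p \<and> b \<in> ideal_pow p m}"

definition ideal_rel :: "'a::comm_ring_1 set \<Rightarrow> ('a \<times> 'a) set" where
  "ideal_rel J = {(x, y). x - y \<in> J}"

definition quot :: "'a::comm_ring_1 set \<Rightarrow> 'a set set" where
  "quot J = UNIV // ideal_rel J"

text \<open>Classical definition: a Noetherian integrally closed domain in which every nonzero
  prime ideal is maximal.  Integral closedness is stated without the fraction field:
  if \<open>a/b\<close> (with \<open>b \<noteq> 0\<close>) is a root of a monic polynomial over \<open>T\<close>, then \<open>b\<close> divides \<open>a\<close>.\<close>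
definition dedekind_domain :: "'a::idom itself \<Rightarrow> bool" where
  "dedekind_domain _ \<longleftrightarrow>
     (\<forall>I::'a set. is_ideal I \<longrightarrow> (\<exists>S. finite S \<and> I = ideal_gen S)) \<and>
     (\<forall>a b::'a. \<forall>d::nat. \<forall>c::nat \<Rightarrow> 'a. b \<noteq> 0 \<and>
         a ^ Suc d + (\<Sum>i\<le>d. c i * a ^ i * b ^ (Suc d - i)) = 0 \<longrightarrow> b dvd a) \<and>
     (\<forall>p::'a set. is_prime_ideal p \<and> p \<noteq> {0} \<longrightarrow> is_maximal_ideal p)"

definition finite_residues :: "'a::comm_ring_1 itself \<Rightarrow> bool" where
  "finite_residues _ \<longleftrightarrow>
     (\<forall>J::'a set. is_ideal J \<and> J \<noteq> {0} \<and> J \<noteq> UNIV \<longrightarrow> finite (quot J))"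

text \<open>The additive group \<open>T/I\<close> is isomorphic to \<open>(\<int>/p\<int>)^m\<close> for a prime \<open>p\<close> and \<open>m > 0\<close>.
  The isomorphism is given on representatives: \<open>f\<close> maps \<open>{..<m} \<rightarrow> {..<p}\<close> to \<open>T\<close>, and
  \<open>x \<mapsto> f x mod I\<close> is an additive bijection onto \<open>T/I\<close>.\<close>
definition elem_abelian_quot :: "'a::comm_ring_1 set \<Rightarrow> bool" where
  "elem_abelian_quot I \<longleftrightarrow>
     (\<exists>(p::nat) (m::nat) (f::(nat \<Rightarrow> nat) \<Rightarrow> 'a). prime p \<and> m > 0 \<and>
        (let V = {..<m} \<rightarrow>\<^sub>E {..<p} in
          (\<forall>x\<in>V. \<forall>y\<in>V. f (restrict (\<lambda>i. (x i + y i) mod p) {..<m}) - f x - f y \<in> I) \<and>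
          (\<forall>t. \<exists>x\<in>V. t - f x \<in> I) \<and>
          (\<forall>x\<in>V. \<forall>y\<in>V. f x - f y \<in> I \<longrightarrow> x = y)))"

definition Ical :: "'a::comm_ring_1 set set" where
  "Ical = {I. is_ideal I \<and> I \<noteq> {0} \<and> elem_abelian_quot I}"

text \<open>A proper affine \<open>\<bbbF>_p\<close>-subspace of the elementary abelian group \<open>T/I\<close> is a coset of a
  proper subgroup of \<open>T/I\<close>; its preimage in \<open>T\<close> is \<open>a + W\<close> with \<open>W\<close> an additive subgroup
  of \<open>T\<close> with \<open>I \<subseteq> W \<noteq> T\<close>.\<close>
definition add_subgroup :: "'a::ab_group_add set \<Rightarrow> bool" where
  "add_subgroup W \<longleftrightarrow> 0 \<in> W \<and> (\<forall>x\<in>W. \<forall>y\<in>W. x + y \<in> W) \<and> (\<forall>x\<in>W. - x \<in> W)"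

definition quot_balanced :: "'a::comm_ring_1 set \<Rightarrow> real \<Rightarrow> 'a pmf \<Rightarrow> bool" where
  "quot_balanced I e y \<longleftrightarrow>
     (\<forall>W a. add_subgroup W \<and> I \<subseteq> W \<and> W \<noteq> UNIV \<longrightarrow>
        measure_pmf.prob y {t. t - a \<in> W} \<le> 1 - e)"

definition eps_balanced :: "('a::comm_ring_1 set \<Rightarrow> real) \<Rightarrow> 'a pmf \<Rightarrow> bool" where
  "eps_balanced \<epsilon> y \<longleftrightarrow> (\<forall>I\<in>Ical. quot_balanced I (\<epsilon> I) y)"

text \<open>An element of \<open>T_p = lim T/p^m\<close> is represented by a compatible sequence \<open>x\<close>
  (\<open>x m\<close> represents an element of \<open>T/p^m\<close>); two sequences are equal in \<open>T_p\<close> iff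
  \<open>x m - y m \<in> p^m\<close> for all \<open>m\<close>.\<close>
definition compatible_seq :: "'a::comm_ring_1 set \<Rightarrow> (nat \<Rightarrow> 'a) \<Rightarrow> bool" where
  "compatible_seq p x \<longleftrightarrow> (\<forall>m. x (Suc m) - x m \<in> ideal_pow p m)"

definition compl_prod :: "'a::comm_ring_1 set set \<Rightarrow> ('a set \<Rightarrow> nat \<Rightarrow> 'a) set" where
  "compl_prod P = {a. (\<forall>p\<in>P. compatible_seq p (a p)) \<and> (\<forall>p. p \<notin> P \<longrightarrow> a p = (\<lambda>_. 0))}"

definition Avec :: "'a::comm_ring_1 set set \<Rightarrow> nat \<Rightarrow> (nat \<Rightarrow> 'a set \<Rightarrow> nat \<Rightarrow> 'a) set" where
  "Avec P n = {v. (\<forall>r<n. v r \<in> compl_prod P) \<and> (\<forall>r\<ge>n. v r = (\<lambda>_ _. 0))}"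

definition cok_tensor_rel ::
  "'a::comm_ring_1 set set \<Rightarrow> nat \<Rightarrow> nat \<Rightarrow> (nat \<times> nat \<Rightarrow> 'a)
     \<Rightarrow> ((nat \<Rightarrow> 'a set \<Rightarrow> nat \<Rightarrow> 'a) \<times> (nat \<Rightarrow> 'a set \<Rightarrow> nat \<Rightarrow> 'a)) set" where
  "cok_tensor_rel P n u M =
     {(v, v'). v \<in> Avec P n \<and> v' \<in> Avec P n \<and>
        (\<exists>w\<in>Avec P (n + u). \<forall>r<n. \<forall>p\<in>P. \<forall>m.
           v r p m - v' r p m - (\<Sum>c<n + u. M (r, c) * w c p m) \<in> ideal_pow p m)}"

text \<open>\<open>cok(M) \<otimes>_T A \<cong> A^n / M(A^(n+u))\<close> (right exactness of \<open>\<otimes>\<close>).\<close>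
definition cok_tensor ::
  "'a::comm_ring_1 set set \<Rightarrow> nat \<Rightarrow> nat \<Rightarrow> (nat \<times> nat \<Rightarrow> 'a)
     \<Rightarrow> (nat \<Rightarrow> 'a set \<Rightarrow> nat \<Rightarrow> 'a) set set" where
  "cok_tensor P n u M = Avec P n // cok_tensor_rel P n u M"

definition matrix_law :: "nat \<Rightarrow> nat \<Rightarrow> (nat \<Rightarrow> nat \<Rightarrow> 'a::zero pmf) \<Rightarrow> (nat \<times> nat \<Rightarrow> 'a) pmf" where
  "matrix_law n u \<mu> = Pi_pmf ({..<n} \<times> {..<n + u}) 0 (\<lambda>(i, j). \<mu> i j)"

end

theory Submission
  imports Defs
begin

text \<open>
  Fix one \<open>p \<in> P\<close>. The completed cokernel is finite as soon as the first \<open>n\<close> columns of the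
  matrix are linearly independent, and this holds with probability tending to 1 by an argument in
  the style of Komlos. A column lies in the span of the \<open>j\<close> columns before it with probability at
  most \<open>q\<^sup>n\<^sup>-\<^sup>j\<close>, where \<open>q < 1\<close> bounds all point masses (Odlyzko); the sum over
  \<open>j < n - L\<close> is small once \<open>L\<close> is large. For the last \<open>L\<close> columns, the same bound applied to
  rows shows that no nonzero vector with a bounded number of nonzero coordinates annihilates the
  first \<open>n - L\<close> columns. Hence some linear form with many nonzero coefficients annihilates the
  preceding columns, and it vanishes on the next column with small probability, because such forms
  in balanced variables do not concentrate at a point: this is seen \<open>p\<close>-adically.
\<close>

section \<open>Localization at a nonzero prime\<close>

text \<open>Independence is meant over the fraction field, but everything stays inside
  \<open>T\<close>: dependence is tested by linear forms with coefficients in \<open>T\<close>, and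
  the localization at \<open>p\<close> is divisibility up to a factor outside \<open>p\<close>. The
  hypothesis controls an entry only modulo ideals with elementary abelian quotient, whereas a point
  bound \<delta> by equidistribution needs a quotient with more than 1/\<delta> elements, hence
  powers \<open>p^m\<close>, whose quotients need not be elementary abelian. A Frattini argument
  closes the gap: a proper subgroup of \<open>T/p^m\<close> stays proper after adding all multiples
  of the prime number contained in \<open>p\<close>. The entries may have different laws, so
  equidistribution modulo \<open>p^m\<close> must be uniform in them; it comes from letting the set
  of residues of substantial mass grow until it is everything. One prime serves for all of
  \<open>P\<close>, because independent columns give a single nonzero \<open>D\<close> with
  \<open>D T^n\<close> inside the image of \<open>M\<close>, and this makes the completed cokernel
  finite at every prime.\<close>

lemma is_idealD:
  assumes "is_ideal I"
  shows "0 \<in> I" "x \<in> I \<Longrightarrow> y \<in> I \<Longrightarrow> x + y \<in> I" "x \<in> I \<Longrightarrow> - x \<in> I"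
    "x \<in> I \<Longrightarrow> r * x \<in> I" "x \<in> I \<Longrightarrow> x * r \<in> I" "x \<in> I \<Longrightarrow> y \<in> I \<Longrightarrow> x - y \<in> I"
proof -
  show "0 \<in> I" and add: "x \<in> I \<Longrightarrow> y \<in> I \<Longrightarrow> x + y \<in> I" for x y
    using assms by (auto simp: is_ideal_def)
  show "x \<in> I \<Longrightarrow> r * x \<in> I" "x \<in> I \<Longrightarrow> x * r \<in> I" for x
    using assms by (auto simp: is_ideal_def mult.commute)
  show neg: "x \<in> I \<Longrightarrow> - x \<in> I" for x
    using assms by (auto simp: is_ideal_def)
  show "x \<in> I \<Longrightarrow> y \<in> I \<Longrightarrow> x - y \<in> I" for x y
    using add[of x "- y"] neg[of y] by simp
qed

lemma is_ideal_sum: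
  assumes "is_ideal I" "\<And>i. i \<in> A \<Longrightarrow> f i \<in> I"
  shows "sum f A \<in> I"
  using assms(2)
  by (induction A rule: infinite_finite_induct) (auto intro: is_idealD[OF assms(1)])

lemma is_ideal_gen: "is_ideal (ideal_gen S)"
  unfolding ideal_gen_def is_ideal_def by blast

lemma ideal_gen_superset: "S \<subseteq> ideal_gen S"
  unfolding ideal_gen_def by blast

lemma ideal_gen_least: "is_ideal I \<Longrightarrow> S \<subseteq> I \<Longrightarrow> ideal_gen S \<subseteq> I"
  unfolding ideal_gen_def by blast

lemma is_ideal_pow: "is_ideal (ideal_pow p k)"
  by (cases k) (auto simp: is_ideal_gen, simp add: is_ideal_def)

lemma is_ideal_eq_UNIV_iff: "is_ideal I \<Longrightarrow> I = UNIV \<longleftrightarrow> 1 \<in> I"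
  using is_idealD(4)[of I 1] by auto

lemma is_ideal_Union_chain:
  assumes "\<And>k. is_ideal (J k)" "\<And>k. J k \<subseteq> J (Suc k)"
  shows "is_ideal (\<Union>k::nat. J k)"
proof -
  have mono: "J i \<subseteq> J j" if "i \<le> j" for i j
    using that by (rule lift_Suc_mono_le[of J, OF assms(2)])
  have "x + y \<in> (\<Union>k. J k)" if xy: "x \<in> J i" "y \<in> J j" for x y i j
  proof -
    have "x \<in> J (max i j)" "y \<in> J (max i j)"
      using xy mono[of i "max i j"] mono[of j "max i j"] by auto
    then show ?thesis using is_idealD(2)[OF assms(1)] by blast
  qed
  moreover have "r * x \<in> (\<Union>k. J k)" "- x \<in> (\<Union>k. J k)" if "x \<in> J i" for r x i
    using is_idealD(3,4)[OF assms(1) that] by blast+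
  ultimately show ?thesis
    unfolding is_ideal_def using is_idealD(1)[OF assms(1)] by auto
qed

section \<open>Noetherian arguments\<close>

lemma noetherian_chain_stable:
  assumes noeth: "\<And>I::'a::comm_ring_1 set. is_ideal I \<Longrightarrow> \<exists>S. finite S \<and> I = ideal_gen S"
    and J: "\<And>k. is_ideal (J k :: 'a set)" "\<And>k. J k \<subseteq> J (Suc k)"
  shows "\<exists>k. J (Suc k) = J k"
proof -
  have mono: "J i \<subseteq> J j" if "i \<le> j" for i j
    using that by (rule lift_Suc_mono_le[of J, OF J(2)])
  obtain S where S: "finite S" "(\<Union>k. J k) = ideal_gen S"
    using noeth[OF is_ideal_Union_chain[of J, OF J]] by blast
  have "\<forall>x\<in>S. \<exists>k. x \<in> J k"
    using S(2) ideal_gen_superset[of S] by blast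
  then obtain f where f: "x \<in> J (f x)" if "x \<in> S" for x by metis
  have "S \<subseteq> J (Max (insert 0 (f ` S)))"
  proof
    fix x assume x: "x \<in> S"
    then have "f x \<le> Max (insert 0 (f ` S))" using S(1) by simp
    then show "x \<in> J (Max (insert 0 (f ` S)))" using f[OF x] mono by blast
  qed
  then have "J (Suc (Max (insert 0 (f ` S)))) \<subseteq> J (Max (insert 0 (f ` S)))"
    using S(2) ideal_gen_least[OF J(1)] by blast
  then show ?thesis using J(2) by blast
qed

lemma noetherian_maximal_element:
  assumes noeth: "\<And>I::'a::comm_ring_1 set. is_ideal I \<Longrightarrow> \<exists>S. finite S \<and> I = ideal_gen S"
    and F: "J0 \<in> \<F>" "\<And>J. J \<in> \<F> \<Longrightarrow> is_ideal (J :: 'a set)"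
  shows "\<exists>J\<in>\<F>. \<forall>J'\<in>\<F>. J \<subseteq> J' \<longrightarrow> J' = J"
proof (rule ccontr)
  assume "\<not> ?thesis"
  then have "\<forall>J\<in>\<F>. \<exists>J'\<in>\<F>. J \<subseteq> J' \<and> J' \<noteq> J" by blast
  then obtain g where g: "g J \<in> \<F>" "J \<subseteq> g J" "g J \<noteq> J" if "J \<in> \<F>" for J by metis
  define C where "C k = (g ^^ k) J0" for k
  have C: "C k \<in> \<F>" for k
    by (induction k) (auto simp: C_def F(1) g(1))
  have "\<exists>k. C (Suc k) = C k"
    by (rule noetherian_chain_stable[OF noeth]) (use C F(2) g(2) in \<open>auto simp: C_def\<close>)
  then show False using g(3)[OF C] by (auto simp: C_def)
qed

lemma ideal_combination:
  fixes g :: "nat \<Rightarrow> 'a::comm_ring_1"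
  assumes "x \<in> ideal_gen (g ` {..k})"
  shows "\<exists>r. x = (\<Sum>i\<le>k. r i * g i)"
proof -
  let ?J = "{x. \<exists>r. x = (\<Sum>i\<le>k. r i * g i)}"
  have "is_ideal ?J"
    unfolding is_ideal_def
  proof (intro conjI ballI allI)
    show "0 \<in> ?J" by (auto intro!: exI[of _ "\<lambda>_. 0"])
  next
    fix x y assume "x \<in> ?J" "y \<in> ?J"
    then obtain r s where "x = (\<Sum>i\<le>k. r i * g i)" "y = (\<Sum>i\<le>k. s i * g i)" by auto
    then show "x + y \<in> ?J"
      by (auto intro!: exI[of _ "\<lambda>i. r i + s i"] simp: algebra_simps sum.distrib)
  next
    fix x assume "x \<in> ?J"
    then obtain r where "x = (\<Sum>i\<le>k. r i * g i)" by auto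
    then show "- x \<in> ?J"
      by (auto intro!: exI[of _ "\<lambda>i. - r i"] simp: sum_negf)
  next
    fix a x assume "x \<in> ?J"
    then obtain r where "x = (\<Sum>i\<le>k. r i * g i)" by auto
    then show "a * x \<in> ?J"
      by (auto intro!: exI[of _ "\<lambda>i. a * r i"] simp: sum_distrib_left mult.assoc)
  qed
  moreover have "g ` {..k} \<subseteq> ?J"
  proof
    fix y assume "y \<in> g ` {..k}"
    then obtain j where j: "j \<le> k" "y = g j" by auto
    then have "y = (\<Sum>i\<le>k. (if i = j then 1 else 0) * g i)"
      by (simp add: if_distrib[of "\<lambda>z. z * _"] cong: if_cong)
    then show "y \<in> ?J" by (intro CollectI exI)
  qed
  ultimately show ?thesis using ideal_gen_least assms by blast
qed

text \<open>If \<open>(b/a) p \<subseteq> p\<close>, then the ideals generated by \<open>c, c(b/a), \<dots>, c(b/a)\<^sup>k\<close>, for a fixed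
  nonzero \<open>c \<in> p\<close>, form an ascending chain, and its stabilization is an equation of integral
  dependence for \<open>b/a\<close>.\<close>
lemma dvd_of_multiplier:
  fixes a b :: "'a::idom"
  assumes ded: "dedekind_domain TYPE('a)" and p: "p \<noteq> {0}" "is_ideal p" and a: "a \<noteq> 0"
    and mult: "\<And>x. x \<in> p \<Longrightarrow> \<exists>y\<in>p. b * x = a * y"
  shows "a dvd b"
proof -
  from p(1) is_idealD(1)[OF p(2)] obtain c where c: "c \<in> p" "c \<noteq> 0" by auto
  from mult obtain f where f: "f x \<in> p" "b * x = a * f x" if "x \<in> p" for x by metis
  define g where "g k = (f ^^ k) c" for k
  have gp: "g k \<in> p" for k
    by (induction k) (auto simp: g_def c f)
  have g: "a ^ k * g k = b ^ k * c" for k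
  proof (induction k)
    case (Suc k)
    have "a ^ Suc k * g (Suc k) = a ^ k * (b * g k)"
      using f(2)[OF gp[of k]] by (simp add: g_def)
    also have "\<dots> = b ^ Suc k * c" using Suc by (simp add: algebra_simps)
    finally show ?case .
  qed (simp add: g_def)
  have "\<exists>k. ideal_gen (g ` {..Suc k}) = ideal_gen (g ` {..k})"
  proof (rule noetherian_chain_stable)
    show "\<exists>S. finite S \<and> I = ideal_gen S" if "is_ideal I" for I :: "'a set"
      using ded that by (auto simp: dedekind_domain_def)
    show "ideal_gen (g ` {..k}) \<subseteq> ideal_gen (g ` {..Suc k})" for k
      by (rule ideal_gen_least[OF is_ideal_gen])
        (use ideal_gen_superset[of "g ` {..Suc k}"] in auto)
  qed (rule is_ideal_gen)
  then obtain k where k: "ideal_gen (g ` {..Suc k}) = ideal_gen (g ` {..k})" by blast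
  have "g (Suc k) \<in> ideal_gen (g ` {..Suc k})"
    using ideal_gen_superset[of "g ` {..Suc k}"] by auto
  then obtain r where r: "g (Suc k) = (\<Sum>i\<le>k. r i * g i)"
    unfolding k using ideal_combination by blast
  have "b ^ Suc k * c = a ^ Suc k * (\<Sum>i\<le>k. r i * g i)"
    using g[of "Suc k"] r by simp
  also have "\<dots> = (\<Sum>i\<le>k. r i * b ^ i * a ^ (Suc k - i)) * c"
    unfolding sum_distrib_left sum_distrib_right
  proof (rule sum.cong[OF refl])
    fix i assume "i \<in> {..k}"
    then have "a ^ Suc k = a ^ (Suc k - i) * a ^ i"
      by (simp flip: power_add)
    then have "a ^ Suc k * (r i * g i) = r i * a ^ (Suc k - i) * (a ^ i * g i)"
      by (simp only: ac_simps)
    then show "a ^ Suc k * (r i * g i) = r i * b ^ i * a ^ (Suc k - i) * c"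
      by (simp only: g) (simp only: ac_simps)
  qed
  finally have "b ^ Suc k = (\<Sum>i\<le>k. r i * b ^ i * a ^ (Suc k - i))"
    using c(2) by simp
  then have eq: "b ^ Suc k + (\<Sum>i\<le>k. (- r i) * b ^ i * a ^ (Suc k - i)) = 0"
    by (simp add: sum_negf)
  have integral: "y dvd x"
    if "y \<noteq> 0" "x ^ Suc d + (\<Sum>i\<le>d. f i * x ^ i * y ^ (Suc d - i)) = 0"
    for x y :: 'a and d :: nat and f
    using ded[unfolded dedekind_domain_def, THEN conjunct2, THEN conjunct1, rule_format, OF conjI, OF that] .
  show ?thesis by (rule integral[of _ _ _ "\<lambda>i. - r i", OF a eq])
qed

text \<open>Finitely many denominators multiply into one that still avoids the prime
  \<open>p\<close>, and the elements for which this one works form an ideal.\<close>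

lemma ideal_annihilator_uniform:
  fixes p :: "'a::idom set"
  assumes prime: "is_prime_ideal p" and "finite S" and S: "\<And>x. x \<in> S \<Longrightarrow> \<exists>s. s \<notin> p \<and> a dvd s * x"
  shows "\<exists>s. s \<notin> p \<and> (\<forall>x\<in>ideal_gen S. a dvd s * x)"
proof -
  from \<open>finite S\<close> S have "\<exists>s. s \<notin> p \<and> (\<forall>x\<in>S. a dvd s * x)"
  proof (induction S rule: finite_induct)
    case empty
    show ?case using prime by (auto simp: is_prime_ideal_def)
  next
    case (insert x S)
    then obtain s s' where s: "s \<notin> p" "\<forall>x\<in>S. a dvd s * x" "s' \<notin> p" "a dvd s' * x" by blast
    then have "s * s' \<notin> p" using prime by (auto simp: is_prime_ideal_def)
    moreover have "a dvd (s * s') * y" if "y \<in> insert x S" for y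
      using that s by (auto simp: mult.assoc) (metis dvd_mult mult.left_commute)
    ultimately show ?case by blast
  qed
  then obtain s where s: "s \<notin> p" "\<forall>x\<in>S. a dvd s * x" by blast
  have "is_ideal {x. a dvd s * x}"
    by (auto simp: is_ideal_def distrib_left mult.left_commute[of s])
  then have "ideal_gen S \<subseteq> {x. a dvd s * x}"
    using s by (intro ideal_gen_least) auto
  with s show ?thesis by blast
qed

text \<open>The localization at \<open>p\<close> is a discrete valuation ring: \<open>w\<close>
  generates its maximal ideal and \<open>t\<close> is a common denominator. A maximal proper
  conductor \<open>(a : b)\<close> is prime, hence equal to \<open>p\<close>, so \<open>b/a\<close>
  lies outside the localization but multiplies \<open>p\<close> into it. Integral closedness forbids
  that \<open>p\<close> is mapped into \<open>p\<close>, so some \<open>w\<close> in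
  \<open>p\<close> is mapped to a unit \<open>t\<close>.\<close>

lemma exists_uniformizer:
  fixes p :: "'a::idom set"
  assumes ded: "dedekind_domain TYPE('a)" and prime: "is_prime_ideal p" and nz: "p \<noteq> {0}"
  shows "\<exists>w t. w \<in> p \<and> t \<notin> p \<and> (\<forall>x\<in>p. w dvd t * x)"
proof -
  have noeth: "\<exists>S. finite S \<and> I = ideal_gen S" if "is_ideal I" for I :: "'a set"
    using ded that by (auto simp: dedekind_domain_def)
  have maxi: "is_maximal_ideal q" if "is_prime_ideal q" "q \<noteq> {0}" for q :: "'a set"
    using ded that by (auto simp: dedekind_domain_def)
  have ip: "is_ideal p" and pne: "p \<noteq> UNIV"
    and pmul: "\<And>x y. x \<notin> p \<Longrightarrow> y \<notin> p \<Longrightarrow> x * y \<notin> p"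
    using prime by (auto simp: is_prime_ideal_def)
  have one: "1 \<notin> p" using ip pne is_ideal_eq_UNIV_iff by blast
  from nz is_idealD(1)[OF ip] obtain a where a: "a \<in> p" "a \<noteq> 0" by auto
  \<comment> \<open>The conductor \<open>(a : b)\<close> computed in the localization at \<open>p\<close>.\<close>
  define Q where "Q b = {x. \<exists>s. s \<notin> p \<and> a dvd s * b * x}" for b
  have Qid: "is_ideal (Q b)" for b
    unfolding is_ideal_def
  proof (intro conjI ballI allI)
    fix x y assume "x \<in> Q b" "y \<in> Q b"
    then obtain s s' where s: "s \<notin> p" "a dvd s * b * x" "s' \<notin> p" "a dvd s' * b * y"
      by (auto simp: Q_def)
    have "a dvd s' * (s * b * x) + s * (s' * b * y)" using s by simp
    also have "\<dots> = (s * s') * b * (x + y)" by (simp add: algebra_simps)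
    finally show "x + y \<in> Q b" using pmul s by (auto simp: Q_def)
  next
    fix r x assume "x \<in> Q b"
    then obtain s where "s \<notin> p" "a dvd s * b * x" by (auto simp: Q_def)
    then show "r * x \<in> Q b"
      by (auto simp: Q_def mult.left_commute[of _ r] intro!: exI[of _ s])
  qed (use one in \<open>auto simp: Q_def\<close>)
  have "\<exists>J\<in>{Q b | b. 1 \<notin> Q b}. \<forall>J'\<in>{Q b | b. 1 \<notin> Q b}. J \<subseteq> J' \<longrightarrow> J' = J"
  proof (rule noetherian_maximal_element[OF noeth])
    have "1 \<notin> Q 1"
    proof
      assume "1 \<in> Q 1"
      then obtain s where s: "s \<notin> p" "a dvd s" by (auto simp: Q_def)
      then show False using a is_idealD(5)[OF ip] by (auto elim: dvdE)
    qed
    then show "Q 1 \<in> {Q b | b. 1 \<notin> Q b}" by blast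
  qed (use Qid in auto)
  then obtain b where b: "1 \<notin> Q b" and bmax: "\<And>b'. 1 \<notin> Q b' \<Longrightarrow> Q b \<subseteq> Q b' \<Longrightarrow> Q b' = Q b"
    by auto
  \<comment> \<open>Passing from \<open>b\<close> to \<open>b * y\<close> enlarges the conductor and
    keeps it proper when \<open>y\<close> is outside it. By maximality the two agree, which turns
    \<open>x * y\<close> in \<open>Q b\<close> into \<open>x\<close> in \<open>Q b\<close>.\<close>
  have Qprime: "is_prime_ideal (Q b)"
    unfolding is_prime_ideal_def
  proof (intro conjI allI impI)
    show "Q b \<noteq> UNIV" using b by blast
  next
    fix x y assume xy: "x * y \<in> Q b"
    show "x \<in> Q b \<or> y \<in> Q b"
    proof (rule disjCI)
      assume "y \<notin> Q b"
      then have "1 \<notin> Q (b * y)" by (auto simp: Q_def mult.assoc)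
      moreover have "Q b \<subseteq> Q (b * y)"
        unfolding Q_def by (smt (verit) Collect_mono dvd_mult2 mult.assoc mult.commute)
      ultimately have "Q (b * y) = Q b" by (rule bmax)
      moreover have "x \<in> Q (b * y)" using xy by (auto simp: Q_def ac_simps)
      ultimately show "x \<in> Q b" by blast
    qed
  qed (rule Qid)
  have "a \<in> Q b" using one by (auto simp: Q_def)
  then have "is_maximal_ideal (Q b)" using maxi Qprime a by blast
  \<comment> \<open>An element outside \<open>p\<close> is a unit of the localization and cannot lie
    in a proper conductor.\<close>
  moreover have "Q b \<subseteq> p"
  proof (rule ccontr)
    assume "\<not> Q b \<subseteq> p"
    then obtain z s where z: "z \<notin> p" "s \<notin> p" "a dvd s * b * z" by (auto simp: Q_def)
    then have "s * z \<notin> p" "a dvd (s * z) * b * 1" using pmul by (auto simp: ac_simps)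
    then show False using b unfolding Q_def by blast
  qed
  ultimately have Qp: "Q b = p" using ip pne by (auto simp: is_maximal_ideal_def)
  obtain S where S: "finite S" "p = ideal_gen S" using noeth ip by blast
  have "\<exists>s. s \<notin> p \<and> (\<forall>x\<in>ideal_gen ((*) b ` S). a dvd s * x)"
  proof (rule ideal_annihilator_uniform[OF prime])
    show "\<exists>s. s \<notin> p \<and> a dvd s * x" if "x \<in> (*) b ` S" for x
    proof -
      from that obtain y where y: "y \<in> S" "x = b * y" by auto
      then have "y \<in> Q b" using Qp S ideal_gen_superset by blast
      then show ?thesis by (auto simp: Q_def y ac_simps)
    qed
  qed (use S in simp)
  then obtain s where s: "s \<notin> p" "\<And>x. x \<in> S \<Longrightarrow> a dvd s * (b * x)"
    using ideal_gen_superset by blast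
  \<comment> \<open>The factor \<open>s\<close> clears denominators on generators of
    \<open>p\<close>, so \<open>b'/a\<close> maps \<open>p\<close> into \<open>T\<close> itself, the
    setting of \<open>dvd_of_multiplier\<close>.\<close>
  define b' where "b' = s * b"
  have "is_ideal {x. a dvd b' * x}"
    by (auto simp: is_ideal_def distrib_left mult.left_commute[of b'])
  then have "p \<subseteq> {x. a dvd b' * x}"
    unfolding S(2) by (rule ideal_gen_least) (use s(2) in \<open>auto simp: b'_def mult.assoc\<close>)
  then have b'p: "a dvd b' * x" if "x \<in> p" for x using that by blast
  have ndvd: "\<not> a dvd b'"
    using s b by (auto simp: Q_def b'_def)
  \<comment> \<open>Otherwise \<open>b'/a\<close> would map \<open>p\<close> into \<open>p\<close>
    and so be integral over \<open>T\<close>, hence an element of \<open>T\<close>.\<close>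
  have "\<exists>w\<in>p. \<forall>y\<in>p. b' * w \<noteq> a * y"
    using dvd_of_multiplier[OF ded nz ip a(2)] ndvd by blast
  then obtain w where w: "w \<in> p" "\<forall>y\<in>p. b' * w \<noteq> a * y" by blast
  obtain t where t: "b' * w = a * t" using b'p[OF w(1)] by (auto elim: dvdE)
  have "w dvd t * x" if x: "x \<in> p" for x
  proof -
    obtain y where y: "b' * x = a * y" using b'p[OF x] by (auto elim: dvdE)
    have "a * (t * x) = a * (w * y)"
      using t y by (metis mult.assoc mult.left_commute)
    then show ?thesis using a(2) by simp
  qed
  moreover have "t \<notin> p" using w(2) t by blast
  ultimately show ?thesis using w(1) by blast
qed

text \<open>Here \<open>w\<close> is a uniformizer of the localization at \<open>p\<close>, and
  \<open>t\<close> makes this visible in \<open>T\<close>: every \<open>x\<close> in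
  \<open>p\<close> is \<open>w * y / t\<close> with \<open>y\<close> in \<open>T\<close>.\<close>

locale uniformized_prime =
  fixes p :: "'a::idom set" and w t :: 'a
  assumes prime: "is_prime_ideal p" and maximal: "is_maximal_ideal p"
    and nonzero: "p \<noteq> {0}" and w_in: "w \<in> p" and t_notin: "t \<notin> p"
    and w_dvd: "\<And>x. x \<in> p \<Longrightarrow> w dvd t * x"
    and noeth: "\<And>I::'a set. is_ideal I \<Longrightarrow> \<exists>S. finite S \<and> I = ideal_gen S"
begin

section \<open>Arithmetic in the localization\<close>

lemma ideal: "is_ideal p"
  using prime by (simp add: is_prime_ideal_def)

lemma mult_notin: "x \<notin> p \<Longrightarrow> y \<notin> p \<Longrightarrow> x * y \<notin> p"
  using prime by (auto simp: is_prime_ideal_def)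

lemma one_notin: "1 \<notin> p"
  using prime is_ideal_eq_UNIV_iff by (auto simp: is_prime_ideal_def)

lemma power_notin: "x \<notin> p \<Longrightarrow> x ^ k \<notin> p"
  by (induction k) (auto simp: one_notin mult_notin)

lemma w_nonzero: "w \<noteq> 0"
proof
  assume "w = 0"
  then have "t * x = 0" if "x \<in> p" for x using w_dvd[OF that] by simp
  then have "p \<subseteq> {0}" using t_notin is_idealD(1)[OF ideal] by auto
  then show False using nonzero is_idealD(1)[OF ideal] by auto
qed

lemma pow_mult: "x \<in> p \<Longrightarrow> y \<in> ideal_pow p k \<Longrightarrow> x * y \<in> ideal_pow p (Suc k)"
  using ideal_gen_superset[of "{a * b | a b. a \<in> p \<and> b \<in> ideal_pow p k}"] by auto

lemma power_in: "x \<in> p \<Longrightarrow> x ^ k \<in> ideal_pow p k"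
proof (induction k)
  case (Suc k)
  then show ?case using pow_mult[of x "x ^ k" k] by simp
qed simp

text \<open>Maximality gives \<open>1 = z + s * r\<close> with \<open>z\<close> in \<open>p\<close>.
  Then \<open>s\<close> divides \<open>1 - z\<close>, hence also \<open>1 - z ^ k\<close>, and
  \<open>z ^ k\<close> lies in \<open>p^k\<close>.\<close>

lemma inverse_mod_pow:
  assumes "s \<notin> p"
  shows "\<exists>r. 1 - s * r \<in> ideal_pow p k"
proof -
  let ?J = "{z + s * r | z r. z \<in> p}"
  have "is_ideal ?J"
    unfolding is_ideal_def
  proof (intro conjI ballI allI)
    show "0 \<in> ?J" using is_idealD(1)[OF ideal] by force
  next
    fix x y assume "x \<in> ?J" "y \<in> ?J"
    then obtain z r z' r' where "x = z + s * r" "y = z' + s * r'" "z \<in> p" "z' \<in> p" by blast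
    then have "x + y = (z + z') + s * (r + r')" "z + z' \<in> p"
      using is_idealD(2)[OF ideal] by (auto simp: algebra_simps)
    then show "x + y \<in> ?J" by blast
  next
    fix x assume "x \<in> ?J"
    then obtain z r where "x = z + s * r" "z \<in> p" by blast
    then have "- x = - z + s * (- r)" "- z \<in> p"
      using is_idealD(3)[OF ideal] by (auto simp: algebra_simps)
    then show "- x \<in> ?J" by blast
  next
    fix a x assume "x \<in> ?J"
    then obtain z r where "x = z + s * r" "z \<in> p" by blast
    then have "a * x = a * z + s * (a * r)" "a * z \<in> p"
      by (auto simp: distrib_left mult.left_commute is_idealD(4)[OF ideal])
    then show "a * x \<in> ?J" by blast
  qed
  moreover have "p \<subseteq> ?J" by (force intro: exI[of _ 0])
  moreover have "s \<in> ?J" using is_idealD(1)[OF ideal] by (force intro: exI[of _ 1])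
  ultimately have "?J = UNIV" using maximal assms unfolding is_maximal_ideal_def by blast
  then have "1 \<in> ?J" by blast
  then obtain z r where zr: "1 = z + s * r" "z \<in> p" by blast
  have "s dvd 1 - z ^ k"
  proof -
    have "1 - z dvd 1 - z ^ k" by (simp add: one_diff_power_eq)
    then show ?thesis using zr(1) by (metis add_diff_cancel_left' dvd_mult_left)
  qed
  then obtain r' where "1 - z ^ k = s * r'" by (auto elim: dvdE)
  then have "1 - s * r' = z ^ k" by (simp add: algebra_simps)
  then show ?thesis using power_in[OF zr(2)] by metis
qed

lemma dvd_of_pow:
  assumes "x \<in> ideal_pow p k"
  shows "w ^ k dvd t ^ k * x"
  using assms
proof (induction k arbitrary: x)
  case (Suc k)
  have "is_ideal {x. w ^ Suc k dvd t ^ Suc k * x}"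
    by (auto simp: is_ideal_def distrib_left mult.left_commute[of "t ^ Suc k"] simp del: power_Suc)
  moreover have "{a * b | a b. a \<in> p \<and> b \<in> ideal_pow p k} \<subseteq> {x. w ^ Suc k dvd t ^ Suc k * x}"
  proof clarify
    fix a b assume "a \<in> p" "b \<in> ideal_pow p k"
    then have "w * w ^ k dvd (t * a) * (t ^ k * b)"
      using Suc.IH w_dvd by (intro mult_dvd_mono)
    then show "w ^ Suc k dvd t ^ Suc k * (a * b)" by (simp add: ac_simps)
  qed
  ultimately have "ideal_pow p (Suc k) \<subseteq> {x. w ^ Suc k dvd t ^ Suc k * x}"
    unfolding ideal_pow.simps by (rule ideal_gen_least)
  then show ?case using Suc.prems by blast
qed simp

text \<open>\<open>p^k\<close> is the contraction of the ideal generated by \<open>w ^ k\<close> in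
  the localization; from here on, powers of \<open>p\<close> are handled by divisibility. The
  converse inverts the denominator modulo \<open>p^k\<close>.\<close>

lemma mem_pow_iff: "x \<in> ideal_pow p k \<longleftrightarrow> (\<exists>s. s \<notin> p \<and> w ^ k dvd s * x)"
proof
  assume "x \<in> ideal_pow p k"
  then show "\<exists>s. s \<notin> p \<and> w ^ k dvd s * x"
    using dvd_of_pow power_notin t_notin by blast
next
  assume "\<exists>s. s \<notin> p \<and> w ^ k dvd s * x"
  then obtain s y where s: "s \<notin> p" "s * x = w ^ k * y" unfolding dvd_def by blast
  obtain r where r: "1 - s * r \<in> ideal_pow p k" using inverse_mod_pow[OF s(1)] by blast
  have "x = (1 - s * r) * x + r * y * w ^ k"
    using s(2) by (simp add: algebra_simps)
  moreover have "(1 - s * r) * x + r * y * w ^ k \<in> ideal_pow p k"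
    using r power_in[OF w_in, of k]
    by (blast intro: is_idealD(2,4,5)[OF is_ideal_pow])
  ultimately show "x \<in> ideal_pow p k" by simp
qed

lemma pow_antimono: "i \<le> j \<Longrightarrow> ideal_pow p j \<subseteq> ideal_pow p i"
  unfolding mem_pow_iff subset_iff by (meson dvd_trans le_imp_power_dvd)

lemma pow_one: "ideal_pow p 1 = p"
proof
  show "ideal_pow p 1 \<subseteq> p"
    unfolding One_nat_def ideal_pow.simps
    by (rule ideal_gen_least[OF ideal]) (auto intro: is_idealD(5)[OF ideal])
  show "p \<subseteq> ideal_pow p 1"
    using power_in[of _ 1] by auto
qed

lemma w_power_mem_iff: "w ^ i \<in> ideal_pow p j \<longleftrightarrow> j \<le> i"
proof
  assume "w ^ i \<in> ideal_pow p j"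
  then obtain s where s: "s \<notin> p" "w ^ j dvd s * w ^ i" unfolding mem_pow_iff by blast
  show "j \<le> i"
  proof (rule ccontr)
    assume "\<not> j \<le> i"
    then have "w ^ Suc i dvd w ^ j" by (intro le_imp_power_dvd) auto
    then have "w ^ i * w dvd w ^ i * s" using s(2) by (metis dvd_trans mult.commute power_Suc)
    then have "w dvd s" using w_nonzero by simp
    then show False using s(1) w_in is_idealD(5)[OF ideal] by (auto elim: dvdE)
  qed
next
  assume "j \<le> i"
  then show "w ^ i \<in> ideal_pow p j" using pow_antimono power_in[OF w_in] by blast
qed

text \<open>In the localization, \<open>a\<close> is \<open>w ^ k\<close> times the unit
  \<open>y / t ^ k\<close>.\<close>

lemma unit_part:
  assumes "a \<in> ideal_pow p k" "a \<notin> ideal_pow p (Suc k)"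
  shows "\<exists>y. y \<notin> p \<and> t ^ k * a = w ^ k * y"
proof -
  obtain y where y: "t ^ k * a = w ^ k * y" using dvd_of_pow[OF assms(1)] by (auto elim: dvdE)
  have "y \<notin> p"
  proof
    assume "y \<in> p"
    then have "w ^ k * w dvd w ^ k * (t * y)" using w_dvd by simp
    also have "\<dots> = t ^ Suc k * a" using y by (simp add: ac_simps)
    finally show False
      using assms(2) power_notin[OF t_notin] unfolding mem_pow_iff by (metis power_Suc2)
  qed
  with y show ?thesis by blast
qed

lemma pow_cancel:
  assumes a: "a \<in> ideal_pow p k" "a \<notin> ideal_pow p (Suc k)" and ax: "a * x \<in> ideal_pow p (k + m)"
  shows "x \<in> ideal_pow p m"
proof -
  obtain y where y: "y \<notin> p" "t ^ k * a = w ^ k * y" using unit_part[OF a] by blast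
  obtain s where s: "s \<notin> p" "w ^ (k + m) dvd s * (a * x)" using ax unfolding mem_pow_iff by blast
  then have "w ^ k * w ^ m dvd t ^ k * (s * (a * x))" by (simp add: power_add)
  also have "t ^ k * (s * (a * x)) = w ^ k * ((s * y) * x)"
    using y(2) by (metis mult.assoc mult.left_commute)
  finally have "w ^ m dvd (s * y) * x" using w_nonzero by simp
  then show ?thesis unfolding mem_pow_iff using mult_notin s(1) y(1) by blast
qed

text \<open>Krull intersection. If \<open>x\<close> lay in all powers, the chain of conductors
  \<open>J k = (x : w ^ k)\<close> would stabilize. With \<open>x = w ^ Suc k * y / s\<close>, the
  element \<open>y\<close> is in \<open>J (Suc k) = J k\<close>, so \<open>w ^ k * y\<close> is
  already a multiple of \<open>x\<close>; then \<open>x\<close> is a multiple of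
  \<open>w * x\<close>, and \<open>w\<close> would be a unit.\<close>

lemma exists_valuation:
  assumes "x \<noteq> 0"
  shows "\<exists>k. x \<in> ideal_pow p k \<and> x \<notin> ideal_pow p (Suc k)"
proof (rule ccontr)
  assume contra: "\<not> ?thesis"
  have all: "x \<in> ideal_pow p k" for k
    by (induction k) (use contra in auto)
  define J where "J k = {y. \<exists>s. s \<notin> p \<and> x dvd s * w ^ k * y}" for k
  have "\<exists>k. J (Suc k) = J k"
  proof (rule noetherian_chain_stable[OF noeth])
    show "is_ideal (J k)" for k
      unfolding is_ideal_def
    proof (intro conjI ballI allI)
      fix y z assume "y \<in> J k" "z \<in> J k"
      then obtain s s' where s: "s \<notin> p" "x dvd s * w ^ k * y" "s' \<notin> p" "x dvd s' * w ^ k * z"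
        by (auto simp: J_def)
      have "x dvd s' * (s * w ^ k * y) + s * (s' * w ^ k * z)" using s by simp
      also have "\<dots> = (s * s') * w ^ k * (y + z)" by (simp add: algebra_simps)
      finally show "y + z \<in> J k" using mult_notin s by (auto simp: J_def)
    next
      fix r y assume "y \<in> J k"
      then obtain s where "s \<notin> p" "x dvd s * w ^ k * y" by (auto simp: J_def)
      then show "r * y \<in> J k"
        by (auto simp: J_def mult.left_commute[of _ r] intro!: exI[of _ s])
    qed (use one_notin in \<open>auto simp: J_def\<close>)
    show "J k \<subseteq> J (Suc k)" for k
    proof
      fix y assume "y \<in> J k"
      then obtain s where s: "s \<notin> p" "x dvd s * w ^ k * y" by (auto simp: J_def)
      then have "x dvd w * (s * w ^ k * y)" by simp
      then show "y \<in> J (Suc k)" using s by (auto simp: J_def ac_simps)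
    qed
  qed
  then obtain k where k: "J (Suc k) = J k" by blast
  obtain s y where s: "s \<notin> p" "s * x = w ^ Suc k * y"
    using all[of "Suc k"] unfolding mem_pow_iff dvd_def by blast
  have "y \<in> J (Suc k)"
    using one_notin s(2) unfolding J_def by (auto simp flip: s(2) simp del: power_Suc intro!: exI[of _ 1])
  then obtain s' r where r: "s' \<notin> p" "s' * w ^ k * y = x * r"
    unfolding k by (auto simp: J_def dvd_def)
  have "x * (s' * s) = s' * (w ^ Suc k * y)" using s(2) by (simp add: ac_simps)
  also have "\<dots> = x * (w * r)" using r(2) by (simp add: ac_simps)
  finally have "s' * s = w * r" using assms by simp
  then show False using mult_notin[OF r(1) s(1)] is_idealD(5)[OF ideal w_in] by simp
qed

text \<open>\<open>d\<close> generates the same ideal of the localization as \<open>w ^ k\<close>.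
  Inverting its unit part modulo \<open>p^m\<close> solves \<open>d * y = x\<close> to precision
  \<open>m + k\<close>.\<close>

lemma pow_subset_multiples:
  assumes d: "d \<in> ideal_pow p k" "d \<notin> ideal_pow p (Suc k)" and x: "x \<in> ideal_pow p k"
  shows "\<exists>y. d * y - x \<in> ideal_pow p (m + k)"
proof -
  obtain z where z: "z \<notin> p" "t ^ k * d = w ^ k * z" using unit_part[OF d] by blast
  obtain y where y: "t ^ k * x = w ^ k * y" using dvd_of_pow[OF x] by (auto elim: dvdE)
  obtain r where "1 - z * r \<in> ideal_pow p m" using inverse_mod_pow[OF z(1)] by blast
  then obtain s e where s: "s \<notin> p" "s * (1 - z * r) = w ^ m * e"
    unfolding mem_pow_iff dvd_def by blast
  have "(s * t ^ k) * (x - d * (r * y)) = s * (t ^ k * x) - s * (t ^ k * d) * r * y"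
    by (simp add: algebra_simps)
  also have "\<dots> = w ^ k * (s * (1 - z * r)) * y"
    unfolding y z(2) by (simp add: algebra_simps)
  also have "\<dots> = w ^ (m + k) * (e * y)"
    unfolding s(2) by (simp add: power_add ac_simps)
  finally have "x - d * (r * y) \<in> ideal_pow p (m + k)"
    unfolding mem_pow_iff using mult_notin[OF s(1) power_notin[OF t_notin, of k]]
    by (metis dvd_triv_left)
  from is_idealD(3)[OF is_ideal_pow this] show ?thesis by auto
qed

end

lemma exists_uniformized_prime:
  fixes p :: "'a::idom set"
  assumes ded: "dedekind_domain TYPE('a)" and "is_prime_ideal p" "p \<noteq> {0}"
  shows "\<exists>w t. uniformized_prime p w t"
proof -
  obtain w t where "w \<in> p" "t \<notin> p" "\<forall>x\<in>p. w dvd t * x"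
    using exists_uniformizer[OF assms] by blast
  then have "uniformized_prime p w t"
    using assms by unfold_locales (auto simp: dedekind_domain_def)
  then show ?thesis by blast
qed

section \<open>Random vectors in proper subspaces\<close>

text \<open>Gaussian elimination without division: the coordinate \<open>c\<close> is cleared with
  the pivot \<open>v s0 c\<close> by cross multiplication, so that coefficients stay in the
  domain.\<close>

lemma dependent_of_card_gt:
  fixes v :: "'s \<Rightarrow> 'c \<Rightarrow> 'a::idom"
  assumes "finite C" "finite S" "card C < card S"
  shows "\<exists>x. (\<exists>s\<in>S. x s \<noteq> 0) \<and> (\<forall>c\<in>C. (\<Sum>s\<in>S. x s * v s c) = 0)"
  using assms
proof (induction C arbitrary: S v rule: finite_induct)
  case empty
  then have "S \<noteq> {}" by auto
  then show ?case by (auto intro!: exI[of _ "\<lambda>_. 1"])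
next
  case (insert c C)
  show ?case
  proof (cases "\<forall>s\<in>S. v s c = 0")
    case True
    have "card C < card S" using insert by simp
    from insert.IH[OF insert.prems(1) this, of v] True show ?thesis by auto
  next
    case False
    then obtain s0 where s0: "s0 \<in> S" "v s0 c \<noteq> 0" by blast
    let ?S = "S - {s0}"
    have "finite ?S" "card C < card ?S" using insert s0 by auto
    then obtain x where x: "\<exists>s\<in>?S. x s \<noteq> 0"
      "\<And>d. d \<in> C \<Longrightarrow> (\<Sum>s\<in>?S. x s * (v s0 c * v s d - v s c * v s0 d)) = 0"
      using insert.IH[of ?S "\<lambda>s d. v s0 c * v s d - v s c * v s0 d"] by blast
    \<comment> \<open>The coefficient at \<open>s0\<close> is the one that makes coordinate
      \<open>c\<close> cancel; the nonzero pivot as common factor keeps the relation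
      nontrivial.\<close>
    define y where "y = (\<lambda>s. if s = s0 then - (\<Sum>s\<in>?S. x s * v s c) else x s * v s0 c)"
    have y: "(\<Sum>s\<in>S. y s * v s d) = (\<Sum>s\<in>?S. x s * (v s0 c * v s d - v s c * v s0 d))" for d
    proof -
      have "(\<Sum>s\<in>S. y s * v s d) = y s0 * v s0 d + (\<Sum>s\<in>?S. y s * v s d)"
        using s0 insert.prems by (intro sum.remove) auto
      also have "(\<Sum>s\<in>?S. y s * v s d) = (\<Sum>s\<in>?S. x s * (v s0 c * v s d))"
        by (rule sum.cong) (auto simp: y_def)
      also have "y s0 * v s0 d = - (\<Sum>s\<in>?S. x s * (v s c * v s0 d))"
        by (simp add: y_def sum_distrib_right mult.assoc)
      finally show ?thesis by (simp add: right_diff_distrib sum_subtractf)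
    qed
    have "(\<Sum>s\<in>S. y s * v s d) = 0" if "d \<in> insert c C" for d
      using that x(2) by (auto simp: y mult.commute)
    moreover have "\<exists>s\<in>S. y s \<noteq> 0" using x(1) s0(2) by (auto simp: y_def)
    ultimately show ?thesis by blast
  qed
qed

section \<open>Conditioning in product laws\<close>

lemma prob_bind_pmf_le:
  assumes "\<And>x. x \<in> G \<Longrightarrow> measure_pmf.prob (f x) E \<le> c"
    and "\<And>x. x \<notin> G \<Longrightarrow> measure_pmf.prob (f x) E = 0" and c: "0 \<le> c"
  shows "measure_pmf.prob (bind_pmf M f) E \<le> c * measure_pmf.prob M G"
proof -
  have "emeasure (measure_pmf (bind_pmf M f)) E = (\<integral>\<^sup>+x. emeasure (measure_pmf (f x)) E \<partial>measure_pmf M)"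
    by simp
  also have "\<dots> \<le> (\<integral>\<^sup>+x. ennreal c * indicator G x \<partial>measure_pmf M)"
    using assms by (intro nn_integral_mono)
      (auto simp: measure_pmf.emeasure_eq_measure indicator_def intro!: ennreal_leI)
  also have "\<dots> = ennreal (c * measure_pmf.prob M G)"
    using c by (simp add: nn_integral_cmult measure_pmf.emeasure_eq_measure ennreal_mult)
  finally show ?thesis
    using c by (simp add: measure_pmf.emeasure_eq_measure)
qed

text \<open>Fubini: the coordinates in \<open>B\<close> are drawn first and frozen at
  \<open>Y\<close>; a bound uniform in \<open>Y\<close> survives averaging.\<close>

lemma prob_Pi_pmf_conditional_le:
  assumes "finite A" "finite B" "A \<inter> B = {}" "0 \<le> c"
    and "\<And>Y. measure_pmf.prob (Pi_pmf A d \<mu>) {X. (\<lambda>i. if i \<in> A then X i else Y i) \<in> E} \<le> c"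
  shows "measure_pmf.prob (Pi_pmf (A \<union> B) d \<mu>) E \<le> c"
proof -
  have "Pi_pmf (A \<union> B) d \<mu> =
    bind_pmf (Pi_pmf B d \<mu>) (\<lambda>Y. map_pmf (\<lambda>X i. if i \<in> A then X i else Y i) (Pi_pmf A d \<mu>))"
    unfolding Pi_pmf_union[OF assms(1-3)] pair_pmf_def map_pmf_def
    by (subst bind_commute_pmf) (simp add: bind_assoc_pmf bind_return_pmf)
  also have "measure_pmf.prob \<dots> E \<le> c * measure_pmf.prob (Pi_pmf B d \<mu>) UNIV"
    using assms(4,5) by (intro prob_bind_pmf_le) (auto simp: vimage_def)
  finally show ?thesis by simp
qed

lemma prob_linear_equation_le:
  fixes a b :: "'a::idom"
  assumes "\<And>x. pmf \<nu> x \<le> q" "a \<noteq> 0" "0 \<le> q"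
  shows "measure_pmf.prob \<nu> {x. a * x = b} \<le> q"
proof (cases "\<exists>z. a * z = b")
  case True
  then obtain z where z: "a * z = b" by blast
  then have "{x. a * x = b} = {z}" using assms(2) by auto
  then show ?thesis using assms(1) by (simp add: measure_pmf_single)
qed (use assms in simp)

text \<open>Odlyzko's bound: on a subspace of dimension at most \<open>card C\<close>, all but \<open>card C\<close> of the
  coordinates are determined by the others.\<close>
lemma prob_in_subspace_le:
  fixes v :: "'c \<Rightarrow> 'i \<Rightarrow> 'a::idom"
  assumes fin: "finite A" "finite C" and q: "0 \<le> q" "q \<le> 1"
    and atoms: "\<And>i x. i \<in> A \<Longrightarrow> pmf (\<mu> i) x \<le> q"
  shows "measure_pmf.prob (Pi_pmf A d \<mu>)
    {X. \<forall>F. (\<forall>c\<in>C. (\<Sum>i\<in>A. F i * v c i) = 0) \<longrightarrow> (\<Sum>i\<in>A. F i * X i) = 0}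
    \<le> q ^ (card A - card C)" (is "measure_pmf.prob _ ?E \<le> _")
proof -
  \<comment> \<open>A largest set \<open>R\<close> of coordinates without a linear relation holding
    on all \<open>v c\<close> has at most \<open>card C\<close> elements, and any further coordinate
    depends on those in \<open>R\<close>.\<close>
  define dep where "dep R \<longleftrightarrow>
    (\<exists>x. (\<exists>i\<in>R. x i \<noteq> 0) \<and> (\<forall>c\<in>C. (\<Sum>i\<in>R. x i * v c i) = 0))" for R
  have "\<exists>R. (R \<subseteq> A \<and> \<not> dep R) \<and> (\<forall>R'. R' \<subseteq> A \<and> \<not> dep R' \<longrightarrow> card R' \<le> card R)"
  proof (rule ex_has_greatest_nat)
    show "{} \<subseteq> A \<and> \<not> dep {}" by (simp add: dep_def)
    show "\<forall>R. R \<subseteq> A \<and> \<not> dep R \<longrightarrow> card R < Suc (card A)" using fin by (auto simp: less_Suc_eq_le intro: card_mono)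
  qed
  then obtain R where R: "R \<subseteq> A" "\<not> dep R" "\<And>R'. R' \<subseteq> A \<Longrightarrow> \<not> dep R' \<Longrightarrow> card R' \<le> card R"
    by blast
  have finR: "finite R" using R(1) fin(1) finite_subset by blast
  have cardR: "card R \<le> card C"
    using dependent_of_card_gt[OF fin(2) finR, of "\<lambda>i c. v c i"] R(2)
    unfolding dep_def by (meson not_le)
  have "\<exists>F. F i \<noteq> 0 \<and> (\<forall>c\<in>C. F i * v c i + (\<Sum>r\<in>R. F r * v c r) = 0)" if i: "i \<in> A - R" for i
  proof -
    have "dep (insert i R)"
      using R(3)[of "insert i R"] R(1) finR i by force
    then obtain F where F: "\<exists>j\<in>insert i R. F j \<noteq> 0" "\<forall>c\<in>C. F i * v c i + (\<Sum>r\<in>R. F r * v c r) = 0"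
      using finR i by (auto simp: dep_def)
    have "F i \<noteq> 0"
    proof
      assume "F i = 0"
      then have "dep R" using F by (auto simp: dep_def intro!: exI[of _ F])
      with R(2) show False by blast
    qed
    with F show ?thesis by blast
  qed
  then obtain F where F: "\<And>i. i \<in> A - R \<Longrightarrow> F i i \<noteq> 0"
    "\<And>i c. i \<in> A - R \<Longrightarrow> c \<in> C \<Longrightarrow> F i i * v c i + (\<Sum>r\<in>R. F i r * v c r) = 0"
    by metis
  \<comment> \<open>Extended by zero, the relation \<open>F i\<close> is a linear form that kills
    every \<open>v c\<close>. The event forces it to kill \<open>X\<close> too, so
    \<open>X i\<close> solves one linear equation given the coordinates in \<open>R\<close>.\<close>
  have combine: "(\<Sum>j\<in>A. (if j = i \<or> j \<in> R then F i j else 0) * X j)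
      = F i i * X i + (\<Sum>r\<in>R. F i r * X r)" if i: "i \<in> A - R" for i X
  proof -
    have "(\<Sum>j\<in>A. (if j = i \<or> j \<in> R then F i j else 0) * X j) = (\<Sum>j\<in>insert i R. F i j * X j)"
      using fin R(1) i by (intro sum.mono_neutral_cong_right) auto
    then show ?thesis using finR i by simp
  qed
  have "measure_pmf.prob (Pi_pmf ((A - R) \<union> R) d \<mu>) ?E \<le> q ^ (card A - card C)"
  proof (rule prob_Pi_pmf_conditional_le)
    fix Y
    have "{X. (\<lambda>i. if i \<in> A - R then X i else Y i) \<in> ?E}
      \<subseteq> Pi (A - R) (\<lambda>i. {x. F i i * x = - (\<Sum>r\<in>R. F i r * Y r)})"
    proof clarify
      fix X i
      assume X: "\<forall>F. (\<forall>c\<in>C. (\<Sum>i\<in>A. F i * v c i) = 0) \<longrightarrow>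
          (\<Sum>i\<in>A. F i * (if i \<in> A - R then X i else Y i)) = 0" and i: "i \<in> A" "i \<notin> R"
      have "F i i * X i + (\<Sum>r\<in>R. F i r * (if r \<in> A - R then X r else Y r)) = 0"
        using X[rule_format, of "\<lambda>j. if j = i \<or> j \<in> R then F i j else 0"] combine[of i] F(2)[of i] i
        by simp
      moreover have "(\<Sum>r\<in>R. F i r * (if r \<in> A - R then X r else Y r)) = (\<Sum>r\<in>R. F i r * Y r)"
        by (rule sum.cong) auto
      ultimately show "F i i * X i = - (\<Sum>r\<in>R. F i r * Y r)"
        by (simp add: eq_neg_iff_add_eq_0)
    qed
    then have "measure_pmf.prob (Pi_pmf (A - R) d \<mu>) {X. (\<lambda>i. if i \<in> A - R then X i else Y i) \<in> ?E}
      \<le> measure_pmf.prob (Pi_pmf (A - R) d \<mu>)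
          (Pi (A - R) (\<lambda>i. {x. F i i * x = - (\<Sum>r\<in>R. F i r * Y r)}))"
      by (intro measure_pmf.finite_measure_mono) auto
    also have "\<dots> = (\<Prod>i\<in>A - R. measure_pmf.prob (\<mu> i) {x. F i i * x = - (\<Sum>r\<in>R. F i r * Y r)})"
      using fin by (intro measure_Pi_pmf_Pi) auto
    also have "\<dots> \<le> (\<Prod>i\<in>A - R. q)"
      using F(1) atoms q by (intro prod_mono conjI prob_linear_equation_le) auto
    also have "\<dots> = q ^ (card A - card R)"
      using finR R(1) by (simp add: card_Diff_subset)
    also have "\<dots> \<le> q ^ (card A - card C)"
      using cardR q by (intro power_decreasing) auto
    finally show "measure_pmf.prob (Pi_pmf (A - R) d \<mu>)
      {X. (\<lambda>i. if i \<in> A - R then X i else Y i) \<in> ?E} \<le> q ^ (card A - card C)" .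
  qed (use fin finR q in auto)
  moreover have "(A - R) \<union> R = A" using R(1) by blast
  ultimately show ?thesis by simp
qed

section \<open>Equidistribution in finite quotients\<close>

definition conv_pmf :: "'a::plus pmf \<Rightarrow> 'a pmf \<Rightarrow> 'a pmf" where
  "conv_pmf \<nu> \<rho> = bind_pmf \<nu> (\<lambda>x. map_pmf (\<lambda>y. x + y) \<rho>)"

text \<open>Lists are used because the equidistribution proof cuts the summands into consecutive
  blocks.\<close>

fun sum_law :: "'a::monoid_add pmf list \<Rightarrow> 'a pmf" where
  "sum_law [] = return_pmf 0"
| "sum_law (\<nu> # L) = conv_pmf \<nu> (sum_law L)"

lemma sum_law_append:
  fixes L :: "'a::monoid_add pmf list"
  shows "sum_law (L @ L') = conv_pmf (sum_law L) (sum_law L')"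
proof (induction L)
  case Nil
  have "(+) 0 = (id :: 'a \<Rightarrow> 'a)" by auto
  then show ?case by (simp add: conv_pmf_def bind_return_pmf)
next
  case (Cons \<nu> L)
  have "(\<lambda>z. x + (y + z)) = (+) (x + y)" for x y :: 'a by (auto simp: add.assoc)
  with Cons show ?case
    by (simp add: conv_pmf_def bind_assoc_pmf map_bind_pmf bind_map_pmf pmf.map_comp o_def)
qed

lemma sum_law_Pi_pmf:
  fixes f :: "'i \<Rightarrow> 'b \<Rightarrow> 'a::comm_monoid_add"
  assumes "distinct xs"
  shows "map_pmf (\<lambda>X. \<Sum>i\<in>set xs. f i (X i)) (Pi_pmf (set xs) d \<mu>)
    = sum_law (map (\<lambda>i. map_pmf (f i) (\<mu> i)) xs)"
  using assms
proof (induction xs)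
  case (Cons x xs)
  then have x: "x \<notin> set xs" by simp
  have eq: "(\<Sum>i\<in>set xs. f i (if i = x then y else X i)) = (\<Sum>i\<in>set xs. f i (X i))" for y X
    using x by (intro sum.cong) auto
  have "map_pmf (\<lambda>X. \<Sum>i\<in>set (x # xs). f i (X i)) (Pi_pmf (set (x # xs)) d \<mu>)
    = bind_pmf (\<mu> x) (\<lambda>y. map_pmf (\<lambda>z. f x y + z)
        (map_pmf (\<lambda>X. \<Sum>i\<in>set xs. f i (X i)) (Pi_pmf (set xs) d \<mu>)))"
    using x by (simp add: Pi_pmf_insert' map_bind_pmf pmf.map_comp o_def eq fun_upd_def
        map_pmf_def bind_assoc_pmf bind_return_pmf)
  then show ?case using Cons by (simp add: conv_pmf_def bind_map_pmf)
qed simp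

lemma sum_prob_partition:
  assumes "finite R" "\<And>t. \<exists>!y. y \<in> R \<and> Q y t"
  shows "(\<Sum>y\<in>R. measure_pmf.prob \<nu> {t. Q y t}) = 1"
proof -
  have "(\<Sum>y\<in>R. measure_pmf.prob \<nu> {t. Q y t}) = measure_pmf.prob \<nu> (\<Union>y\<in>R. {t. Q y t})"
    using assms by (intro measure_pmf.finite_measure_finite_Union[symmetric])
      (auto simp: disjoint_family_on_def)
  also have "(\<Union>y\<in>R. {t. Q y t}) = UNIV" using assms(2) by blast
  finally show ?thesis by simp
qed

text \<open>The finite group \<open>T/J\<close> is represented by a transversal \<open>R\<close>
  inside \<open>T\<close>; \<open>cprob\<close> is then the law induced on cosets, and
  \<open>card R\<close> is the index.\<close>

locale finite_index_subgroup =
  fixes J R :: "'a::comm_ring_1 set"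
  assumes subgroup: "add_subgroup J" and finite_R: "finite R"
    and transversal: "\<And>x. \<exists>!y. y \<in> R \<and> x - y \<in> J"
begin

definition cprob :: "'a pmf \<Rightarrow> 'a \<Rightarrow> real" where
  "cprob \<nu> x = measure_pmf.prob \<nu> {t. t - x \<in> J}"

definition rep :: "'a \<Rightarrow> 'a" where
  "rep x = (THE y. y \<in> R \<and> x - y \<in> J)"

lemma rep: "rep x \<in> R" "x - rep x \<in> J"
  using theI'[OF transversal[of x]] by (auto simp: rep_def)

lemma rep_unique: "y \<in> R \<Longrightarrow> x - y \<in> J \<Longrightarrow> rep x = y"
  using transversal[of x] rep[of x] by blast

lemma J_closed: "0 \<in> J" "x \<in> J \<Longrightarrow> y \<in> J \<Longrightarrow> x + y \<in> J" "x \<in> J \<Longrightarrow> - x \<in> J"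
  using subgroup by (auto simp: add_subgroup_def)

lemma J_minus_commute: "x - y \<in> J \<longleftrightarrow> y - x \<in> J"
  using J_closed(3)[of "x - y"] J_closed(3)[of "y - x"] by auto

lemma J_trans: "x - y \<in> J \<Longrightarrow> y - z \<in> J \<Longrightarrow> x - z \<in> J"
  using J_closed(2)[of "x - y" "y - z"] by simp

lemma cprob_cong: "x - y \<in> J \<Longrightarrow> cprob \<nu> x = cprob \<nu> y"
  unfolding cprob_def using J_trans J_minus_commute by (intro arg_cong[where f = "measure_pmf.prob \<nu>"]) blast

lemma cprob_nonneg: "0 \<le> cprob \<nu> x" and cprob_le_1: "cprob \<nu> x \<le> 1"
  by (simp_all add: cprob_def)

lemma sum_cprob: "(\<Sum>y\<in>R. cprob \<nu> y) = 1"
  unfolding cprob_def using finite_R transversal by (rule sum_prob_partition)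

lemma sum_cprob_reflected: "(\<Sum>y\<in>R. cprob \<nu> (z - y)) = 1"
  unfolding cprob_def
proof (rule sum_prob_partition[OF finite_R])
  show "\<exists>!y. y \<in> R \<and> t - (z - y) \<in> J" for t
  proof -
    have "t - (z - y) \<in> J \<longleftrightarrow> (z - t) - y \<in> J" for y
      using J_minus_commute[of t "z - y"] by (simp add: algebra_simps)
    then show ?thesis using transversal[of "z - t"] by simp
  qed
qed

lemma card_R_pos: "0 < card R"
  using finite_R transversal[of 0] by (auto simp: card_gt_0_iff)

lemma cprob_conv: "cprob (conv_pmf \<nu> \<rho>) z = (\<Sum>y\<in>R. cprob \<nu> y * cprob \<rho> (z - y))"
proof -
  have *: "ennreal (cprob \<rho> (z - x))
      = (\<Sum>y\<in>R. ennreal (cprob \<rho> (z - y)) * indicator {t. t - y \<in> J} x)" for x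
  proof -
    have "(\<Sum>y\<in>R. ennreal (cprob \<rho> (z - y)) * indicator {t. t - y \<in> J} x)
      = (\<Sum>y\<in>{rep x}. ennreal (cprob \<rho> (z - y)) * indicator {t. t - y \<in> J} x)"
      using finite_R rep rep_unique by (intro sum.mono_neutral_right) (auto simp: indicator_def)
    also have "\<dots> = ennreal (cprob \<rho> (z - x))"
    proof -
      have "(z - rep x) - (z - x) \<in> J" using rep(2)[of x] by simp
      from cprob_cong[OF this, of \<rho>] show ?thesis using rep(2)[of x] by simp
    qed
    finally show ?thesis ..
  qed
  have "ennreal (cprob (conv_pmf \<nu> \<rho>) z) = (\<integral>\<^sup>+x. ennreal (cprob \<rho> (z - x)) \<partial>measure_pmf \<nu>)"
  proof -
    have "ennreal (cprob (conv_pmf \<nu> \<rho>) z) = emeasure (measure_pmf (conv_pmf \<nu> \<rho>)) {t. t - z \<in> J}"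
      by (simp add: cprob_def measure_pmf.emeasure_eq_measure)
    also have "\<dots> = (\<integral>\<^sup>+x. emeasure (measure_pmf (map_pmf (\<lambda>y. x + y) \<rho>)) {t. t - z \<in> J} \<partial>measure_pmf \<nu>)"
      by (simp add: conv_pmf_def)
    also have "\<dots> = (\<integral>\<^sup>+x. ennreal (cprob \<rho> (z - x)) \<partial>measure_pmf \<nu>)"
      by (intro nn_integral_cong)
        (simp add: cprob_def measure_pmf.emeasure_eq_measure vimage_def algebra_simps)
    finally show ?thesis .
  qed
  also have "\<dots> = (\<integral>\<^sup>+x. (\<Sum>y\<in>R. ennreal (cprob \<rho> (z - y)) * indicator {t. t - y \<in> J} x)
      \<partial>measure_pmf \<nu>)"
    by (intro nn_integral_cong *)
  also have "\<dots> = (\<Sum>y\<in>R. ennreal (cprob \<rho> (z - y)) * emeasure (measure_pmf \<nu>) {t. t - y \<in> J})"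
    by (subst nn_integral_sum) (auto simp: nn_integral_cmult)
  also have "\<dots> = (\<Sum>y\<in>R. ennreal (cprob \<nu> y * cprob \<rho> (z - y)))"
    by (intro sum.cong) (auto simp: measure_pmf.emeasure_eq_measure cprob_def ennreal_mult mult.commute)
  also have "\<dots> = ennreal (\<Sum>y\<in>R. cprob \<nu> y * cprob \<rho> (z - y))"
    by (intro sum_ennreal) (simp add: cprob_nonneg)
  finally show ?thesis
    by (simp add: cprob_nonneg sum_nonneg)
qed

text \<open>Let \<open>A\<close> be the heavy residues of \<rho> and \<open>B\<close> those of
  \<nu>; sums of the two are heavy for the convolution. Without growth, all translates of
  \<open>A\<close> by elements of \<open>B\<close> coincide, so \<open>B\<close> lies in one coset
  of the stabilizer of \<open>A\<close>. If \<open>A\<close> is not everything, this stabilizer is a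
  proper subgroup, and balancedness fails because \<open>B\<close> carries mass more than
  \<open>1 - e\<close>.\<close>

lemma card_heavy_increases:
  assumes bal: "quot_balanced J e \<nu>" and e: "0 < e" "e \<le> 1" and c: "0 \<le> c"
    and ne: "\<exists>x. c \<le> cprob \<rho> x"
  shows "min (card R) (Suc (card {y\<in>R. c \<le> cprob \<rho> y}))
    \<le> card {y\<in>R. e / card R * c \<le> cprob (conv_pmf \<nu> \<rho>) y}"
proof -
  define h where "h = real (card R)"
  define A where "A = {x. c \<le> cprob \<rho> x}"
  define B where "B = {b\<in>R. e / h \<le> cprob \<nu> b}"
  define D where "D = {x. e / h * c \<le> cprob (conv_pmf \<nu> \<rho>) x}"
  have h: "h > 0" using card_R_pos by (simp add: h_def)
  have A_sat: "x \<in> A \<longleftrightarrow> y \<in> A" if "x - y \<in> J" for x y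
    using cprob_cong[OF that] by (simp add: A_def)
  have D_sat: "x \<in> D \<longleftrightarrow> y \<in> D" if "x - y \<in> J" for x y
    using cprob_cong[OF that] by (simp add: D_def)
  have AB: "a + b \<in> D" if "a \<in> A" "b \<in> B" for a b
  proof -
    have "e / h * c \<le> cprob \<nu> b * cprob \<rho> ((a + b) - b)"
      using that c e h by (intro mult_mono) (auto simp: A_def B_def cprob_nonneg)
    also have "\<dots> \<le> (\<Sum>y\<in>R. cprob \<nu> y * cprob \<rho> ((a + b) - y))"
      using that finite_R by (intro member_le_sum) (auto simp: B_def cprob_nonneg)
    finally show ?thesis by (simp add: D_def cprob_conv)
  qed
  \<comment> \<open>The light residues carry total mass less than \<open>e\<close>.\<close>
  have B_mass: "1 - e < measure_pmf.prob \<nu> U" if U: "\<And>t. t \<notin> U \<Longrightarrow> rep t \<notin> B" for U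
  proof (cases "R = B")
    case True
    then have "U = UNIV" using U rep(1) by blast
    then show ?thesis using e by simp
  next
    case False
    then have RB: "R - B \<noteq> {}" by (auto simp: B_def)
    have "measure_pmf.prob \<nu> (- U) \<le> measure_pmf.prob \<nu> (\<Union>y\<in>R - B. {t. t - y \<in> J})"
      using U rep by (intro measure_pmf.finite_measure_mono) auto
    also have "\<dots> \<le> (\<Sum>y\<in>R - B. cprob \<nu> y)"
      unfolding cprob_def using finite_R by (intro measure_pmf.finite_measure_subadditive_finite) auto
    also have "\<dots> < (\<Sum>y\<in>R - B. e / h)"
      using RB finite_R by (intro sum_strict_mono) (auto simp: B_def)
    also have "\<dots> \<le> h * (e / h)"
    proof -
      have "card (R - B) \<le> card R" using finite_R by (intro card_mono) auto
      then have "real (card (R - B)) * (e / h) \<le> h * (e / h)"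
        unfolding h_def using e by (intro mult_right_mono) auto
      then show ?thesis by simp
    qed
    finally have "measure_pmf.prob \<nu> (- U) < e" using h by simp
    moreover have "measure_pmf.prob \<nu> (- U) = 1 - measure_pmf.prob \<nu> U"
      using measure_pmf.prob_compl[of U \<nu>] by (simp add: Compl_eq_Diff_UNIV)
    ultimately show ?thesis by simp
  qed
  have "B \<noteq> {}" using B_mass[of "{}"] e by auto
  then obtain b0 where b0: "b0 \<in> B" by blast
  have inj: "inj_on (\<lambda>y. rep (y + b)) (R \<inter> A)" for b
  proof (rule inj_onI)
    fix x y assume xy: "x \<in> R \<inter> A" "y \<in> R \<inter> A" "rep (x + b) = rep (y + b)"
    have "(x + b) - (y + b) \<in> J"
      using rep(2)[of "x + b"] rep(2)[of "y + b"] xy(3) J_trans J_minus_commute by metis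
    then have "x - y \<in> J" by simp
    then show "x = y" using xy J_closed(1) transversal[of x] by auto
  qed
  have img: "(\<lambda>y. rep (y + b)) ` (R \<inter> A) \<subseteq> R \<inter> D" if "b \<in> B" for b
    using AB[OF _ that] rep D_sat[OF rep(2)] by auto
  have "min (card R) (Suc (card (R \<inter> A))) \<le> card (R \<inter> D)"
  proof (rule ccontr)
    assume "\<not> ?thesis"
    then have small: "card (R \<inter> D) < card R" "card (R \<inter> D) \<le> card (R \<inter> A)" by auto
    \<comment> \<open>Translation by \<open>b\<close> embeds \<open>A\<close> into \<open>D\<close>
      modulo \<open>J\<close>; since \<open>D\<close> is no larger, it is the whole translate, for
      every \<open>b\<close> in \<open>B\<close>.\<close>
    have onto: "(\<lambda>y. rep (y + b)) ` (R \<inter> A) = R \<inter> D" if "b \<in> B" for b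
      using small(2) img[OF that] finite_R inj by (intro card_seteq) (auto simp: card_image)
    have shift: "x + b \<in> D \<longleftrightarrow> x \<in> A" if b: "b \<in> B" for x b
    proof
      assume "x + b \<in> D"
      then have "rep (x + b) \<in> R \<inter> D" using rep D_sat[OF rep(2)] by auto
      then obtain y where y: "y \<in> R \<inter> A" "rep (x + b) = rep (y + b)" unfolding onto[OF b, symmetric] by blast
      have "(x + b) - (y + b) \<in> J"
        using rep(2)[of "x + b"] rep(2)[of "y + b"] y(2) J_trans J_minus_commute by metis
      then show "x \<in> A" using A_sat[of x y] y(1) by simp
    qed (use AB b in blast)
    \<comment> \<open>The stabilizer of \<open>A\<close> under translation; it is proper because
      \<open>A\<close> is neither empty nor everything.\<close>
    define W where "W = {g. \<forall>x. x + g \<in> A \<longleftrightarrow> x \<in> A}"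
    have "add_subgroup W"
      unfolding add_subgroup_def
    proof (intro conjI ballI)
      fix g g' assume g: "g \<in> W" "g' \<in> W"
      have "x + (g + g') \<in> A \<longleftrightarrow> x \<in> A" for x
        using g by (auto simp: W_def simp flip: add.assoc)
      then show "g + g' \<in> W" by (simp add: W_def)
    next
      fix g assume g: "g \<in> W"
      have "x + - g \<in> A \<longleftrightarrow> x \<in> A" for x
      proof -
        have "(x + - g) + g \<in> A \<longleftrightarrow> x + - g \<in> A" using g unfolding W_def by blast
        then show ?thesis by simp
      qed
      then show "- g \<in> W" by (simp add: W_def)
    qed (simp add: W_def)
    moreover have "J \<subseteq> W"
    proof
      fix g assume "g \<in> J"
      then have "x + g \<in> A \<longleftrightarrow> x \<in> A" for x by (intro A_sat) simp
      then show "g \<in> W" by (simp add: W_def)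
    qed
    moreover have "W \<noteq> UNIV"
    proof -
      obtain a where a: "a \<in> A" using ne by (auto simp: A_def)
      have "card (R \<inter> A) < card R"
        using small inj[of b0] img[OF b0] finite_R card_inj_on_le by (metis finite_Int order.strict_trans1)
      then obtain y where "y \<in> R" "y \<notin> A"
        by (metis Int_absorb2 order_less_irrefl subsetI)
      then have "y - a \<notin> W" using a by (auto simp: W_def intro!: exI[of _ a])
      then show ?thesis by blast
    qed
    ultimately have "measure_pmf.prob \<nu> {t. t - b0 \<in> W} \<le> 1 - e"
      using bal unfolding quot_balanced_def by blast
    moreover have "1 - e < measure_pmf.prob \<nu> {t. t - b0 \<in> W}"
    proof (rule B_mass)
      fix t assume t: "t \<notin> {t. t - b0 \<in> W}"
      show "rep t \<notin> B"
      proof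
        assume b: "rep t \<in> B"
        have "x + (t - b0) \<in> A \<longleftrightarrow> x \<in> A" for x
        proof -
          have "x + (t - b0) \<in> A \<longleftrightarrow> x + (t - b0) + b0 \<in> D" using shift[OF b0] by blast
          also have "\<dots> \<longleftrightarrow> x + rep t \<in> D" using rep(2)[of t] by (intro D_sat) simp
          also have "\<dots> \<longleftrightarrow> x \<in> A" using shift[OF b] by blast
          finally show ?thesis .
        qed
        then show False using t by (simp add: W_def)
      qed
    qed
    ultimately show False by simp
  qed
  moreover have "R \<inter> A = {y\<in>R. c \<le> cprob \<rho> y}"
    "R \<inter> D = {y\<in>R. e / card R * c \<le> cprob (conv_pmf \<nu> \<rho>) y}"
    by (auto simp: A_def D_def h_def)
  ultimately show ?thesis by simp
qed

text \<open>The empty sum has one heavy residue, and each summand adds at least one more while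
  lowering the threshold by the factor \<open>e / card R\<close>. After \<open>card R\<close>
  summands every residue is heavy.\<close>

lemma cprob_sum_law_lower:
  assumes bal: "\<forall>\<nu>\<in>set L. quot_balanced J e \<nu>" and e: "0 < e" "e \<le> 1"
    and len: "card R \<le> length L"
  shows "(e / card R) ^ length L \<le> cprob (sum_law L) z"
proof -
  have *: "min (card R) (Suc (length L)) \<le> card {y\<in>R. (e / card R) ^ length L \<le> cprob (sum_law L) y}"
    using bal
  proof (induction L)
    case Nil
    have "rep 0 \<in> {y\<in>R. 1 \<le> cprob (return_pmf 0) y}"
      using rep[of 0] by (simp add: cprob_def measure_return_pmf)
    then have "0 < card {y\<in>R. 1 \<le> cprob (return_pmf 0) y}"
      using finite_R by (subst card_gt_0_iff) auto
    then show ?case by simp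
  next
    case (Cons \<nu> L)
    let ?A = "{y\<in>R. (e / card R) ^ length L \<le> cprob (sum_law L) y}"
    have IH: "min (card R) (Suc (length L)) \<le> card ?A" using Cons by auto
    then have "?A \<noteq> {}" using card_R_pos by (intro notI) simp
    then have "min (card R) (Suc (card ?A))
      \<le> card {y\<in>R. e / card R * (e / card R) ^ length L \<le> cprob (sum_law (\<nu> # L)) y}"
      using card_heavy_increases[of e \<nu> "(e / card R) ^ length L" "sum_law L"] Cons e by auto
    with IH show ?case by (auto simp: min_def split: if_splits)
  qed
  then have "card R \<le> card {y\<in>R. (e / card R) ^ length L \<le> cprob (sum_law L) y}"
    using len by simp
  then have "{y\<in>R. (e / card R) ^ length L \<le> cprob (sum_law L) y} = R"
    using finite_R by (intro card_seteq) auto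
  then have "(e / card R) ^ length L \<le> cprob (sum_law L) (rep z)" using rep(1) by blast
  then show ?thesis using cprob_cong[OF rep(2)] by simp
qed

text \<open>Doeblin minorization: \<nu> contains the mass \<open>c\<close> on each residue. This
  uniform part contributes exactly \<open>c\<close> to the convolution, and the remaining mass
  \<open>1 - card R * c\<close> contributes at most that multiple of \<open>m\<close>.\<close>

lemma cprob_conv_contract:
  fixes c :: real
  assumes lower: "\<And>z. c \<le> cprob \<nu> z" and upper: "\<And>z. cprob \<rho> z \<le> m" and "0 \<le> m"
  shows "cprob (conv_pmf \<nu> \<rho>) z \<le> (1 - card R * c) * m + c"
proof -
  have "cprob (conv_pmf \<nu> \<rho>) z
    = (\<Sum>y\<in>R. (cprob \<nu> y - c) * cprob \<rho> (z - y)) + c * (\<Sum>y\<in>R. cprob \<rho> (z - y))"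
    unfolding cprob_conv by (simp add: sum_distrib_left sum.distrib[symmetric] algebra_simps)
  also have "\<dots> \<le> (\<Sum>y\<in>R. (cprob \<nu> y - c) * m) + c"
    unfolding sum_cprob_reflected
    using lower upper by (intro add_mono sum_mono mult_left_mono) auto
  also have "(\<Sum>y\<in>R. (cprob \<nu> y - c) * m) = (1 - card R * c) * m"
    using sum_cprob[of \<nu>] by (simp add: sum_subtractf flip: sum_distrib_right)
  finally show ?thesis .
qed

text \<open>Each block of \<open>card R\<close> summands satisfies the minorization with
  \<open>c = (e / card R) ^ card R\<close>. The map
  \<open>m \<mapsto> (1 - card R * c) * m + c\<close> has the fixed point \<open>1 / card R\<close>,
  so the excess over it shrinks geometrically in the number \<open>b\<close> of blocks.\<close>

lemma cprob_sum_law_upper: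
  assumes bal: "\<forall>\<nu>\<in>set L. quot_balanced J e \<nu>" and e: "0 < e" "e \<le> 1"
    and len: "b * card R \<le> length L"
  shows "cprob (sum_law L) z \<le> 1 / card R + (1 - card R * (e / card R) ^ card R) ^ b"
  using bal len
proof (induction b arbitrary: L z)
  case 0
  show ?case using cprob_le_1[of "sum_law L" z] by (simp add: add_increasing)
next
  case (Suc b)
  define c where "c = (e / card R) ^ card R"
  have h: "real (card R) > 0" using card_R_pos by simp
  have hc: "card R * c \<le> 1"
  proof -
    have "c \<le> (e / card R) ^ 1" unfolding c_def
      using e h card_R_pos by (intro power_decreasing) auto
    then have "card R * c \<le> card R * (e / card R)" using h by (intro mult_left_mono) auto
    then show ?thesis using e h by simp
  qed
  have sets: "set (take (card R) L) \<subseteq> set L" "set (drop (card R) L) \<subseteq> set L"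
    by (auto dest: in_set_takeD in_set_dropD)
  have len: "length (take (card R) L) = card R" using Suc by simp
  have low: "c \<le> cprob (sum_law (take (card R) L)) z" for z
    using cprob_sum_law_lower[of "take (card R) L" e z] Suc.prems e sets(1) len
    unfolding c_def by auto
  have up: "cprob (sum_law (drop (card R) L)) z \<le> 1 / card R + (1 - card R * c) ^ b" for z
  proof -
    have "b * card R \<le> length (drop (card R) L)" using Suc.prems(2) by (simp add: le_diff_conv2)
    moreover have "\<forall>\<nu>\<in>set (drop (card R) L). quot_balanced J e \<nu>" using Suc.prems(1) sets(2) by blast
    ultimately show ?thesis using Suc.IH unfolding c_def by blast
  qed
  have "cprob (sum_law L) z = cprob (conv_pmf (sum_law (take (card R) L)) (sum_law (drop (card R) L))) z"
    by (simp flip: sum_law_append)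
  also have "\<dots> \<le> (1 - card R * c) * (1 / card R + (1 - card R * c) ^ b) + c"
    using hc by (intro cprob_conv_contract low up) auto
  also have "\<dots> = 1 / card R + (1 - card R * c) ^ Suc b"
    using h by (simp add: field_simps)
  finally show ?case unfolding c_def .
qed

lemma cprob_sum_law_eventually:
  assumes e: "0 < e" "e \<le> 1" and "0 < \<delta>"
  shows "\<exists>s. \<forall>L. (\<forall>\<nu>\<in>set L. quot_balanced J e \<nu>) \<longrightarrow> s \<le> length L \<longrightarrow>
    (\<forall>z. cprob (sum_law L) z \<le> 1 / card R + \<delta>)"
proof -
  define r where "r = 1 - card R * (e / card R) ^ card R"
  have h: "real (card R) > 0" using card_R_pos by simp
  have "(e / card R) ^ card R \<le> (e / card R) ^ 1"
    using e h card_R_pos by (intro power_decreasing) auto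
  then have "card R * (e / card R) ^ card R \<le> card R * (e / card R)" using h by (intro mult_left_mono) auto
  then have "0 \<le> r" using e h by (simp add: r_def)
  moreover have "r < 1" using e h by (simp add: r_def)
  ultimately obtain b where b: "r ^ b < \<delta>" using real_arch_pow_inv[of \<delta> r] assms by auto
  have "cprob (sum_law L) z \<le> 1 / card R + \<delta>"
    if "\<forall>\<nu>\<in>set L. quot_balanced J e \<nu>" "b * card R \<le> length L" for L z
    using cprob_sum_law_upper[OF that(1) e that(2), of z] b by (simp add: r_def)
  then show ?thesis by blast
qed

end

section \<open>Balancedness modulo powers of a prime\<close>

lemma quot_eq_image: "quot J = (\<lambda>x. ideal_rel J `` {x}) ` UNIV"
  by (auto simp: quot_def quotient_def)

lemma ideal_class_eq_iff:
  assumes "is_ideal J"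
  shows "ideal_rel J `` {x} = ideal_rel J `` {y} \<longleftrightarrow> x - y \<in> J"
proof
  assume "ideal_rel J `` {x} = ideal_rel J `` {y}"
  moreover have "y \<in> ideal_rel J `` {y}" using is_idealD(1)[OF assms] by (simp add: ideal_rel_def)
  ultimately show "x - y \<in> J" by (auto simp: ideal_rel_def)
next
  assume xy: "x - y \<in> J"
  have "x - z \<in> J \<longleftrightarrow> y - z \<in> J" for z
    using is_idealD(2)[OF assms xy, of "y - z"] is_idealD(6)[OF assms _ xy, of "x - z"] by auto
  then show "ideal_rel J `` {x} = ideal_rel J `` {y}" by (auto simp: ideal_rel_def)
qed

lemma of_int_in_ideal:
  assumes I: "is_ideal I" and l: "of_nat l \<in> (I :: 'a::comm_ring_1 set)" and "int l dvd k"
  shows "of_int k \<in> I"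
proof -
  obtain j where "k = int l * j" using assms(3) by (elim dvdE)
  then have "of_int k = of_int j * (of_nat l :: 'a)" by simp
  then show ?thesis using is_idealD(4)[OF I l] by simp
qed

text \<open>Since the prime \<open>l\<close> is in \<open>I\<close>, the quotient is a vector space
  over the field with \<open>l\<close> elements, and finiteness bounds the length of independent
  families by \<open>l ^ m \<le> card (quot I)\<close>. A longest such family \<open>b\<close> is a
  basis; the isomorphism is the map to linear combinations of \<open>b\<close>.\<close>

lemma elem_abelian_quotI:
  fixes I :: "'a::comm_ring_1 set"
  assumes I: "is_ideal I" "I \<noteq> UNIV" and fin: "finite (quot I)"
    and l: "prime l" "of_nat l \<in> I"
  shows "elem_abelian_quot I"
proof -
  define V where "V m = ({..<m} \<rightarrow>\<^sub>E {..<l} :: (nat \<Rightarrow> nat) set)" for m :: nat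
  define f where "f b m x = (\<Sum>i<m. of_nat (x i) * b i)" for b :: "nat \<Rightarrow> 'a" and m and x :: "nat \<Rightarrow> nat"
  define indep where "indep m \<longleftrightarrow> (\<exists>b. \<forall>x\<in>V m. \<forall>y\<in>V m. f b m x - f b m y \<in> I \<longrightarrow> x = y)" for m
  have V_less: "x i < l" if "x \<in> V m" "i < m" for x i m
    using PiE_mem[of x "{..<m}" "\<lambda>_. {..<l}" i] that by (simp add: V_def)
  have lpos: "0 < l" and l2: "2 \<le> l" using l(1) prime_gt_0_nat prime_ge_2_nat by auto
  have bound: "m < Suc (card (quot I))" if indep: "indep m" for m
  proof -
    obtain b where b: "\<And>x y. x \<in> V m \<Longrightarrow> y \<in> V m \<Longrightarrow> f b m x - f b m y \<in> I \<Longrightarrow> x = y"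
      using indep unfolding indep_def by blast
    have "inj_on (\<lambda>x. ideal_rel I `` {f b m x}) (V m)"
      using b by (auto simp: inj_on_def ideal_class_eq_iff[OF I(1)])
    then have "card (V m) \<le> card (quot I)"
      by (rule card_inj_on_le) (use fin in \<open>auto simp: quot_eq_image\<close>)
    moreover have "card (V m) = l ^ m" by (simp add: V_def card_PiE)
    moreover have "m < 2 ^ m" by (rule less_exp)
    moreover have "2 ^ m \<le> l ^ m" using l2 by (intro power_mono) auto
    ultimately show ?thesis by linarith
  qed
  have "indep 0" by (auto simp: indep_def V_def)
  then obtain m where m: "indep m" "\<And>k. indep k \<Longrightarrow> k \<le> m"
    using ex_has_greatest_nat[of indep 0 "\<lambda>x. x" "Suc (card (quot I))"] bound by blast
  then obtain b where b: "\<And>x y. x \<in> V m \<Longrightarrow> y \<in> V m \<Longrightarrow> f b m x - f b m y \<in> I \<Longrightarrow> x = y"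
    unfolding indep_def by blast
  have reduce: "(\<Sum>i<m. of_int (k i) * b i) - f b m (\<lambda>i\<in>{..<m}. nat (k i mod int l)) \<in> I" for k
  proof -
    have "(\<Sum>i<m. of_int (k i) * b i) - f b m (\<lambda>i\<in>{..<m}. nat (k i mod int l))
      = (\<Sum>i<m. of_int (k i - k i mod int l) * b i)"
      unfolding f_def sum_subtractf[symmetric] using lpos
      by (intro sum.cong) (auto simp: left_diff_distrib)
    moreover have "of_int (k i - k i mod int l) * b i \<in> I" for i
      by (intro is_idealD(5)[OF I(1)] of_int_in_ideal[OF I(1) l(2)]) auto
    ultimately show ?thesis by (simp only: is_ideal_sum[OF I(1)])
  qed
  have reduce_V: "(\<lambda>i\<in>{..<m}. nat (k i mod int l)) \<in> V m" for k
    using lpos by (auto simp: V_def nat_less_iff)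
  have span: "\<exists>x\<in>V m. t - f b m x \<in> I" for t
  proof (rule ccontr)
    assume t: "\<not> ?thesis"
    define b' where "b' = b(m := t)"
    have fb': "f b' (Suc m) x = f b m x + of_nat (x m) * t" for x
      by (simp add: f_def b'_def)
    have "x = y" if xy: "x \<in> V (Suc m)" "y \<in> V (Suc m)" and eq: "f b' (Suc m) x - f b' (Suc m) y \<in> I" for x y
    proof (cases "x m = y m")
      case True
      have r: "f b m (restrict x {..<m}) = f b m x" "f b m (restrict y {..<m}) = f b m y"
        by (auto simp: f_def)
      have restr: "restrict x {..<m} = restrict y {..<m}"
      proof (rule b)
        have "f b m x - f b m y \<in> I" using eq unfolding fb' True by simp
        then show "f b m (restrict x {..<m}) - f b m (restrict y {..<m}) \<in> I" unfolding r .
      qed (use xy in \<open>auto simp: V_def PiE_iff\<close>)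
      have "x i = y i" if "i < m" for i using fun_cong[OF restr, of i] that by simp
      with True have "x i = y i" if "i < Suc m" for i using that by (auto simp: less_Suc_eq)
      then show ?thesis using xy unfolding V_def by (intro PiE_ext) auto
    next
      case False
      define d where "d = int (x m) - int (y m)"
      have "\<not> int l dvd d"
      proof -
        have "x m < l" "y m < l" using V_less[OF xy(1), of m] V_less[OF xy(2), of m] by simp_all
        then have "\<bar>d\<bar> < int l" "d \<noteq> 0" using False by (auto simp: d_def)
        then show ?thesis using dvd_imp_le_int[of d "int l"] by auto
      qed
      then have "coprime (int l) d" using l(1) prime_imp_coprime[of "int l" d] by simp
      \<comment> \<open>\<open>v\<close> inverts the difference \<open>d\<close> of the last
        coefficients modulo \<open>l\<close>. Thus \<open>t\<close> would be a combination of
        \<open>b\<close> modulo \<open>I\<close>, against the choice of \<open>t\<close>.\<close>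
      then obtain u v where uv: "u * int l + v * d = 1"
        using bezout_int[of "int l" d] by auto
      define k where "k i = v * (int (y i) - int (x i))" for i
      have "of_int v * (f b' (Suc m) x - f b' (Suc m) y) + of_int (u * int l) * t \<in> I"
        by (intro is_idealD(2)[OF I(1)] is_idealD(4)[OF I(1) eq] is_idealD(5)[OF I(1)]
            of_int_in_ideal[OF I(1) l(2)]) auto
      also have "of_int v * (f b' (Suc m) x - f b' (Suc m) y) + of_int (u * int l) * t
        = of_int (u * int l + v * d) * t - (\<Sum>i<m. of_int (k i) * b i)"
        unfolding fb' by (simp add: f_def d_def k_def algebra_simps sum_subtractf sum_distrib_left)
      finally have "t - (\<Sum>i<m. of_int (k i) * b i) \<in> I" by (simp add: uv)
      from is_idealD(2)[OF I(1) this reduce[of k]]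
      have "t - f b m (\<lambda>i\<in>{..<m}. nat (k i mod int l)) \<in> I" by simp
      then show ?thesis using t reduce_V by blast
    qed
    then have "indep (Suc m)" unfolding indep_def by blast
    then show False using m(2) by fastforce
  qed
  have "m > 0"
  proof (rule ccontr)
    assume "\<not> m > 0"
    then have "t \<in> I" for t using span[of t] by (auto simp: f_def)
    then show False using I(2) by blast
  qed
  have "f b m (restrict (\<lambda>i. (x i + y i) mod l) {..<m}) - f b m x - f b m y \<in> I" for x y
  proof -
    have "(\<lambda>i\<in>{..<m}. nat ((int (x i) + int (y i)) mod int l)) = restrict (\<lambda>i. (x i + y i) mod l) {..<m}"
      by (auto simp: fun_eq_iff simp flip: of_nat_add of_nat_mod)
    moreover have "(\<Sum>i<m. of_int (int (x i) + int (y i)) * b i) = f b m x + f b m y"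
      by (simp add: f_def algebra_simps sum.distrib)
    ultimately have "f b m x + f b m y - f b m (restrict (\<lambda>i. (x i + y i) mod l) {..<m}) \<in> I"
      using reduce[of "\<lambda>i. int (x i) + int (y i)"] by simp
    from is_idealD(3)[OF I(1) this] show ?thesis by (simp add: algebra_simps)
  qed
  then show ?thesis
    unfolding elem_abelian_quot_def Let_def V_def[symmetric]
    using l(1) \<open>m > 0\<close> span b by (intro exI[of _ l] exI[of _ m] exI[of _ "f b m"] conjI) (auto simp: V_def)
qed

text \<open>Pigeonhole puts a positive integer into \<open>p\<close>. A prime factor of the least
  one is in \<open>p\<close>, because the smaller cofactor is not.\<close>

lemma exists_prime_in_prime_ideal:
  fixes p :: "'a::idom set"
  assumes p: "is_prime_ideal p" and fin: "finite (quot p)"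
  shows "\<exists>l. prime l \<and> of_nat l \<in> p"
proof -
  have ip: "is_ideal p" and one: "1 \<notin> p"
    using p is_ideal_eq_UNIV_iff by (auto simp: is_prime_ideal_def)
  have "\<not> inj_on (\<lambda>n::nat. ideal_rel p `` {of_nat n}) UNIV"
    using fin finite_imageD finite_subset[of _ "quot p"]
    by (metis (mono_tags, lifting) image_subset_iff infinite_UNIV_nat quot_eq_image rangeI)
  then obtain i j :: nat where ij: "i < j" "of_nat j - of_nat i \<in> p"
    unfolding inj_on_def ideal_class_eq_iff[OF ip]
    by (metis UNIV_I is_idealD(3)[OF ip] linorder_neqE_nat minus_diff_eq)
  then have ex: "0 < j - i \<and> of_nat (j - i) \<in> p" by simp
  define n where "n = (LEAST n. 0 < n \<and> of_nat n \<in> p)"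
  have n: "0 < n" "of_nat n \<in> p"
    using LeastI[of "\<lambda>n. 0 < n \<and> of_nat n \<in> p", OF ex] by (auto simp: n_def)
  have least: "n \<le> k" if "0 < k" "of_nat k \<in> p" for k
    unfolding n_def using that by (intro Least_le) auto
  have "n \<noteq> 1" using n(2) one by auto
  then obtain l where l: "prime l" "l dvd n" using prime_factor_nat by blast
  then obtain k where k: "n = l * k" by (elim dvdE)
  have "0 < k" "k < n" using n(1) k l(1) prime_gt_1_nat[of l] by auto
  then have "of_nat k \<notin> p" using least[of k] by auto
  moreover have "of_nat l * of_nat k \<in> p" using n(2) k by simp
  ultimately show ?thesis using l(1) p by (auto simp: is_prime_ideal_def)
qed

lemma add_subgroupD:
  assumes "add_subgroup W"
  shows "0 \<in> W" "x \<in> W \<Longrightarrow> y \<in> W \<Longrightarrow> x + y \<in> W" "x \<in> W \<Longrightarrow> - x \<in> W" "x \<in> W \<Longrightarrow> y \<in> W \<Longrightarrow> x - y \<in> W"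
proof -
  show "0 \<in> W" "x \<in> W \<Longrightarrow> y \<in> W \<Longrightarrow> x + y \<in> W" "x \<in> W \<Longrightarrow> - x \<in> W" for x y
    using assms by (auto simp: add_subgroup_def)
  then show "x \<in> W \<Longrightarrow> y \<in> W \<Longrightarrow> x - y \<in> W" for x y
    by (metis add_uminus_conv_diff)
qed

lemma ideal_add_subgroup: "is_ideal I \<Longrightarrow> add_subgroup I"
  by (simp add: is_ideal_def add_subgroup_def)

lemma add_subgroup_of_nat_mult:
  fixes W :: "'a::comm_ring_1 set"
  assumes "add_subgroup W" "x \<in> W"
  shows "of_nat n * x \<in> W"
  by (induction n) (auto simp: distrib_right add_subgroupD[OF assms(1)] assms(2))

lemma exists_transversal:
  fixes J :: "'a::comm_ring_1 set"
  assumes J: "is_ideal J" and fin: "finite (quot J)"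
  shows "\<exists>R. finite_index_subgroup J R"
proof -
  define g where "g C = (SOME x. ideal_rel J `` {x} = C)" for C
  have g: "x - g (ideal_rel J `` {x}) \<in> J" for x
  proof -
    have "ideal_rel J `` {g (ideal_rel J `` {x})} = ideal_rel J `` {x}"
      unfolding g_def by (rule someI[of _ x]) simp
    then show ?thesis using ideal_class_eq_iff[OF J] by metis
  qed
  have "\<exists>!y. y \<in> g ` quot J \<and> x - y \<in> J" for x
  proof (rule ex1I)
    show "g (ideal_rel J `` {x}) \<in> g ` quot J \<and> x - g (ideal_rel J `` {x}) \<in> J"
      using g by (auto simp: quot_eq_image)
  next
    fix y assume y: "y \<in> g ` quot J \<and> x - y \<in> J"
    then obtain z where z: "y = g (ideal_rel J `` {z})" by (auto simp: quot_eq_image)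
    have "z - x \<in> J"
      using is_idealD(6)[OF J g[of z], of "x - y"] y z by simp
    then have "ideal_rel J `` {z} = ideal_rel J `` {x}" by (simp add: ideal_class_eq_iff[OF J])
    then show "y = g (ideal_rel J `` {x})" using z by simp
  qed
  then have "finite_index_subgroup J (g ` quot J)"
    using fin J by unfold_locales (auto simp: ideal_add_subgroup)
  then show ?thesis by blast
qed

section \<open>From elementary abelian quotients to \<open>T/p^m\<close>\<close>

context uniformized_prime
begin

lemma pow_subset: "0 < m \<Longrightarrow> ideal_pow p m \<subseteq> p"
  using pow_antimono[of 1 m] unfolding pow_one by simp

lemma pow_nonzero: "ideal_pow p m \<noteq> {0}"
proof -
  have "w ^ m \<noteq> 0" using w_nonzero by simp
  then show ?thesis using power_in[OF w_in, of m] by blast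
qed

lemma finite_quot:
  assumes "finite_residues TYPE('a)" "is_ideal I" "I \<noteq> {0}" "I \<subseteq> p"
  shows "finite (quot I)"
proof -
  have "I \<noteq> UNIV" using assms(4) one_notin by blast
  then show ?thesis using assms(1-3) by (simp add: finite_residues_def)
qed

text \<open>Balancedness is assumed for \<open>I = p^m + l T\<close>, whose quotient is elementary
  abelian. Since \<open>l\<close> is nilpotent modulo \<open>p^m\<close>, a proper subgroup
  \<open>W\<close> containing \<open>p^m\<close> stays proper after adding \<open>l T\<close>, as
  for Frattini subgroups of finite \<open>l\<close>-groups. A coset of \<open>W\<close> thus lies in
  a coset of a proper subgroup containing \<open>I\<close>.\<close>

lemma quot_balanced_pow:
  fixes \<epsilon> :: "'a set \<Rightarrow> real"
  assumes res: "finite_residues TYPE('a)" and eps: "\<forall>I\<in>Ical. \<epsilon> I > 0" and m: "0 < m"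
  shows "\<exists>e. 0 < e \<and> e < 1 \<and> (\<forall>\<nu>. eps_balanced \<epsilon> \<nu> \<longrightarrow> quot_balanced (ideal_pow p m) e \<nu>)"
proof -
  have "finite (quot p)" using finite_quot[OF res ideal nonzero] by simp
  then obtain l where l: "prime l" "of_nat l \<in> p" using exists_prime_in_prime_ideal[OF prime] by blast
  define plus where "plus W = {x + of_nat l * y | x y. x \<in> W}" for W :: "'a set"
  have plus_subgroup: "add_subgroup (plus W)" if W: "add_subgroup W" for W
    unfolding add_subgroup_def
  proof (intro conjI ballI)
    have "0 + of_nat l * 0 \<in> plus W" unfolding plus_def using add_subgroupD(1)[OF W] by blast
    then show "0 \<in> plus W" by simp
  next
    fix x y assume "x \<in> plus W" "y \<in> plus W"
    then obtain a b c d where "x = a + of_nat l * b" "y = c + of_nat l * d" "a \<in> W" "c \<in> W"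
      unfolding plus_def by blast
    then have "x + y = (a + c) + of_nat l * (b + d)" "a + c \<in> W"
      using add_subgroupD(2)[OF W] by (auto simp: algebra_simps)
    then show "x + y \<in> plus W" unfolding plus_def by blast
  next
    fix x assume "x \<in> plus W"
    then obtain a b where "x = a + of_nat l * b" "a \<in> W" unfolding plus_def by blast
    then have "- x = (- a) + of_nat l * (- b)" "- a \<in> W"
      using add_subgroupD(3)[OF W] by auto
    then show "- x \<in> plus W" unfolding plus_def by blast
  qed
  define I where "I = plus (ideal_pow p m)"
  have powI: "ideal_pow p m \<subseteq> I"
  proof
    fix x assume "x \<in> ideal_pow p m"
    then have "x + of_nat l * 0 \<in> I" unfolding I_def plus_def by blast
    then show "x \<in> I" by simp
  qed
  have I: "is_ideal I"
  proof -
    have "r * x \<in> I" if x: "x \<in> I" for r x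
    proof -
      obtain a b where "x = a + of_nat l * b" "a \<in> ideal_pow p m"
        using x unfolding I_def plus_def by blast
      then have "r * x = r * a + of_nat l * (r * b)" "r * a \<in> ideal_pow p m"
        using is_idealD(4)[OF is_ideal_pow] by (auto simp: distrib_left mult.left_commute)
      then show ?thesis unfolding I_def plus_def by blast
    qed
    then show ?thesis
      using plus_subgroup[OF ideal_add_subgroup[OF is_ideal_pow]]
      unfolding is_ideal_def add_subgroup_def I_def by blast
  qed
  have Ip: "I \<subseteq> p"
    using pow_subset[OF m] l(2) is_idealD[OF ideal] by (auto simp: I_def plus_def)
  have Inz: "I \<noteq> {0}" using powI pow_nonzero[of m] is_idealD(1)[OF is_ideal_pow] by blast
  have "0 + of_nat l * 1 \<in> I" unfolding I_def plus_def using is_idealD(1)[OF is_ideal_pow] by blast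
  then have "elem_abelian_quot I"
    using I Ip one_notin finite_quot[OF res I Inz Ip] l(1) by (intro elem_abelian_quotI[of _ l]) auto
  then have Ical: "I \<in> Ical" using I Inz by (simp add: Ical_def)
  have proper: "plus W \<noteq> UNIV" if W: "add_subgroup W" "ideal_pow p m \<subseteq> W" "W \<noteq> UNIV" for W
  proof
    assume full: "plus W = UNIV"
    \<comment> \<open>Iterating \<open>T = W + l T\<close> gives \<open>T = W + l^k T\<close>; at
      \<open>k = m\<close> the second term lies in \<open>p^m\<close>, hence in
      \<open>W\<close>.\<close>
    have "\<exists>x\<in>W. \<exists>y. z = x + of_nat (l ^ k) * y" for k z
    proof (induction k)
      case 0
      have "z = 0 + of_nat (l ^ 0) * z" by simp
      then show ?case using add_subgroupD(1)[OF W(1)] by blast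
    next
      case (Suc k)
      then obtain x y where xy: "x \<in> W" "z = x + of_nat (l ^ k) * y" by blast
      obtain x' y' where xy': "x' \<in> W" "y = x' + of_nat l * y'"
        using full unfolding plus_def by blast
      have "z = (x + of_nat (l ^ k) * x') + of_nat (l ^ Suc k) * y'"
        unfolding xy xy' by (simp add: algebra_simps)
      moreover have "x + of_nat (l ^ k) * x' \<in> W"
        by (intro add_subgroupD(2)[OF W(1)] xy(1) add_subgroup_of_nat_mult W(1) xy')
      ultimately show ?case by blast
    qed
    moreover have "of_nat (l ^ m) * y \<in> W" for y
      using W(2) is_idealD(5)[OF is_ideal_pow power_in[OF l(2)], of m y] by auto
    ultimately have "z \<in> W" for z using add_subgroupD(2)[OF W(1)] by metis
    then show False using W(3) by blast
  qed
  \<comment> \<open>The minimum keeps \<open>e\<close> below 1, so that \<open>1 - e\<close> can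
    later serve as a positive ratio.\<close>
  define e where "e = min (\<epsilon> I) (1/2)"
  have "quot_balanced (ideal_pow p m) e \<nu>" if nu: "eps_balanced \<epsilon> \<nu>" for \<nu>
    unfolding quot_balanced_def
  proof (intro allI impI)
    fix W a assume W: "add_subgroup W \<and> ideal_pow p m \<subseteq> W \<and> W \<noteq> UNIV"
    have sub: "W \<subseteq> plus W"
    proof
      fix x assume "x \<in> W"
      then have "x + of_nat l * 0 \<in> plus W" unfolding plus_def by blast
      then show "x \<in> plus W" by simp
    qed
    have "I \<subseteq> plus W" using W unfolding I_def plus_def by blast
    then have "measure_pmf.prob \<nu> {t. t - a \<in> plus W} \<le> 1 - \<epsilon> I"
      using nu Ical proper[of W] plus_subgroup[of W] W unfolding eps_balanced_def quot_balanced_def by blast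
    moreover have "measure_pmf.prob \<nu> {t. t - a \<in> W} \<le> measure_pmf.prob \<nu> {t. t - a \<in> plus W}"
      using sub by (intro measure_pmf.finite_measure_mono) auto
    ultimately show "measure_pmf.prob \<nu> {t. t - a \<in> W} \<le> 1 - e" by (simp add: e_def)
  qed
  then show ?thesis using eps Ical by (intro exI[of _ e]) (auto simp: e_def)
qed

text \<open>Multiplication by \<open>u\<close> is an automorphism of \<open>T/p^m\<close>, so
  preimages of proper subgroups are proper.\<close>

lemma quot_balanced_unit_mult:
  assumes bal: "quot_balanced (ideal_pow p m) e \<nu>" and u: "u \<notin> p" and e: "e \<le> 1"
  shows "quot_balanced (ideal_pow p m) e (map_pmf ((*) u) \<nu>)"
  unfolding quot_balanced_def
proof (intro allI impI)
  fix W a assume W: "add_subgroup W \<and> ideal_pow p m \<subseteq> W \<and> W \<noteq> UNIV"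
  note WD = add_subgroupD[OF W[THEN conjunct1]]
  have prob: "measure_pmf.prob (map_pmf ((*) u) \<nu>) {t. t - a \<in> W} = measure_pmf.prob \<nu> {x. u * x - a \<in> W}"
    by (simp add: vimage_def)
  show "measure_pmf.prob (map_pmf ((*) u) \<nu>) {t. t - a \<in> W} \<le> 1 - e"
  proof (cases "\<exists>x0. u * x0 - a \<in> W")
    case False
    then show ?thesis using e unfolding prob by simp
  next
    case True
    then obtain x0 where x0: "u * x0 - a \<in> W" by blast
    define W' where "W' = {x. u * x \<in> W}"
    have "add_subgroup W'"
      using WD by (auto simp: add_subgroup_def W'_def distrib_left)
    moreover have "ideal_pow p m \<subseteq> W'"
      unfolding W'_def using W is_idealD(4)[OF is_ideal_pow] by blast
    moreover have "W' \<noteq> UNIV"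
    proof
      assume full: "W' = UNIV"
      obtain r where r: "1 - u * r \<in> ideal_pow p m" using inverse_mod_pow[OF u] by blast
      have "z \<in> W" for z
      proof -
        have "(1 - u * r) * z \<in> W" using W is_idealD(5)[OF is_ideal_pow r] by blast
        moreover have "u * (r * z) \<in> W" using full unfolding W'_def by blast
        ultimately have "(1 - u * r) * z + u * (r * z) \<in> W" by (rule WD)
        then show ?thesis by (simp add: algebra_simps)
      qed
      then show False using W by blast
    qed
    ultimately have "measure_pmf.prob \<nu> {t. t - x0 \<in> W'} \<le> 1 - e"
      using bal unfolding quot_balanced_def by blast
    moreover have "{x. u * x - a \<in> W} \<subseteq> {t. t - x0 \<in> W'}"
    proof
      fix x assume "x \<in> {x. u * x - a \<in> W}"
      then have "(u * x - a) - (u * x0 - a) \<in> W" using WD(4) x0 by blast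
      then show "x \<in> {t. t - x0 \<in> W'}" by (simp add: W'_def algebra_simps)
    qed
    then have "measure_pmf.prob \<nu> {x. u * x - a \<in> W} \<le> measure_pmf.prob \<nu> {t. t - x0 \<in> W'}"
      by (intro measure_pmf.finite_measure_mono) auto
    ultimately show ?thesis unfolding prob by linarith
  qed
qed

text \<open>The powers \<open>w ^ 0\<close> to \<open>w ^ m\<close> are distinct modulo
  \<open>p^m\<close>. Hence the uniform mass \<open>1 / card R\<close> becomes as small as desired
  when \<open>m\<close> grows.\<close>

lemma card_transversal_pow:
  assumes "finite_index_subgroup (ideal_pow p m) R"
  shows "m < card R"
proof -
  interpret finite_index_subgroup "ideal_pow p m" R by fact
  have "inj_on (\<lambda>i. rep (w ^ i)) {..m}"
  proof (rule linorder_inj_onI)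
    fix i j assume ij: "i < j" "i \<in> {..m}" "j \<in> {..m}"
    show "rep (w ^ i) \<noteq> rep (w ^ j)"
    proof
      assume "rep (w ^ i) = rep (w ^ j)"
      then have "w ^ i - w ^ j \<in> ideal_pow p m"
        using rep(2)[of "w ^ i"] rep(2)[of "w ^ j"] J_trans J_minus_commute by metis
      then have "w ^ i - w ^ j \<in> ideal_pow p (Suc i)"
        using pow_antimono[of "Suc i" m] ij by auto
      moreover have "w ^ j \<in> ideal_pow p (Suc i)" unfolding w_power_mem_iff using ij by simp
      ultimately have "(w ^ i - w ^ j) + w ^ j \<in> ideal_pow p (Suc i)"
        by (rule is_idealD(2)[OF is_ideal_pow])
      then show False unfolding diff_add_cancel w_power_mem_iff by simp
    qed
  qed auto
  then have "card {..m} \<le> card R"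
    by (rule card_inj_on_le) (auto simp: rep finite_R)
  then show ?thesis by simp
qed

end

section \<open>Anticoncentration of linear forms\<close>

lemma prob_linear_form_subset:
  fixes a :: "'i \<Rightarrow> 'a::comm_ring_1"
  assumes "finite A" "B \<subseteq> A" "0 \<le> c"
    and le: "\<And>x. measure_pmf.prob (Pi_pmf B d \<mu>) {X. (\<Sum>i\<in>B. a i * X i) = x} \<le> c"
  shows "measure_pmf.prob (Pi_pmf A d \<mu>) {X. (\<Sum>i\<in>A. a i * X i) = x} \<le> c"
proof -
  have B: "finite B" using assms finite_subset by blast
  have "measure_pmf.prob (Pi_pmf (B \<union> (A - B)) d \<mu>) {X. (\<Sum>i\<in>A. a i * X i) = x} \<le> c"
  proof (rule prob_Pi_pmf_conditional_le)
    fix Y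
    have "(\<Sum>i\<in>A. a i * (if i \<in> B then X i else Y i))
      = (\<Sum>i\<in>B. a i * X i) + (\<Sum>i\<in>A - B. a i * Y i)" for X
      using sum.subset_diff[OF assms(2,1), of "\<lambda>i. a i * (if i \<in> B then X i else Y i)"]
      by (simp add: add.commute)
    then have "{X. (\<lambda>i. if i \<in> B then X i else Y i) \<in> {X. (\<Sum>i\<in>A. a i * X i) = x}}
      = {X. (\<Sum>i\<in>B. a i * X i) = x - (\<Sum>i\<in>A - B. a i * Y i)}"
      by (auto simp: eq_diff_eq)
    then show "measure_pmf.prob (Pi_pmf B d \<mu>)
      {X. (\<lambda>i. if i \<in> B then X i else Y i) \<in> {X. (\<Sum>i\<in>A. a i * X i) = x}} \<le> c"
      using le by simp
  qed (use assms B in auto)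
  moreover have "B \<union> (A - B) = A" using assms(2) by blast
  ultimately show ?thesis by simp
qed

context uniformized_prime
begin

text \<open>The \<open>p\<close>-adic valuation, meaningful for nonzero arguments only.\<close>

definition val :: "'a \<Rightarrow> nat" where
  "val x = (SOME k. x \<in> ideal_pow p k \<and> x \<notin> ideal_pow p (Suc k))"

lemma val: "x \<noteq> 0 \<Longrightarrow> x \<in> ideal_pow p (val x)" "x \<noteq> 0 \<Longrightarrow> x \<notin> ideal_pow p (Suc (val x))"
  unfolding val_def using someI_ex[OF exists_valuation] by blast+

text \<open>Let \<open>k\<close> be the least valuation, attained at \<open>i\<close>. Modulo
  \<open>p^(k+1)\<close> only the term of \<open>i\<close> survives, which confines
  \<open>X i\<close> to one coset of \<open>p\<close>, of mass at most \<open>1 - e\<close>. The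
  other terms follow by induction with the value at \<open>i\<close> frozen.\<close>

lemma prob_linear_form_distinct_val:
  fixes a :: "'i \<Rightarrow> 'a"
  assumes "finite B" "inj_on (\<lambda>i. val (a i)) B" "\<And>i. i \<in> B \<Longrightarrow> a i \<noteq> 0"
    and "\<And>i. i \<in> B \<Longrightarrow> quot_balanced p e (\<mu> i)" and e: "0 \<le> e" "e \<le> 1"
  shows "measure_pmf.prob (Pi_pmf B d \<mu>) {X. (\<Sum>i\<in>B. a i * X i) = x} \<le> (1 - e) ^ card B"
  using assms(1-4)
proof (induction "card B" arbitrary: B x)
  case 0
  then show ?case by simp
next
  case (Suc n)
  then have "B \<noteq> {}" by auto
  then obtain i where i: "i \<in> B" "\<And>j. j \<in> B \<Longrightarrow> val (a i) \<le> val (a j)"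
    using ex_has_least_nat[of "\<lambda>i. i \<in> B" _ "\<lambda>i. val (a i)"] by blast
  define B' where "B' = B - {i}"
  define k where "k = val (a i)"
  have B': "B = insert i B'" "i \<notin> B'" "finite B'" "card B' = n"
    using i(1) Suc.hyps(2) Suc.prems(1) by (auto simp: B'_def)
  have above: "a j \<in> ideal_pow p (Suc k)" if j: "j \<in> B'" for j
  proof -
    have "val (a j) \<noteq> val (a i)" using Suc.prems(2) i(1) j unfolding inj_on_def B'_def by blast
    then have "Suc k \<le> val (a j)" using i(2)[of j] j by (simp add: k_def B'_def)
    then show ?thesis using pow_antimono val(1)[OF Suc.prems(3)] j B'(1) by blast
  qed
  define G where "G = {y. a i * y - x \<in> ideal_pow p (Suc k)}"
  have coeff_split: "(\<Sum>j\<in>B. a j * (f(i := y)) j) = a i * y + (\<Sum>j\<in>B'. a j * f j)" for f y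
  proof -
    have "(\<Sum>j\<in>B'. a j * (f(i := y)) j) = (\<Sum>j\<in>B'. a j * f j)"
      using B'(2) by (intro sum.cong) auto
    then show ?thesis using B' by simp
  qed
  have law: "Pi_pmf B d \<mu> = bind_pmf (\<mu> i) (\<lambda>y. map_pmf (\<lambda>f. f(i := y)) (Pi_pmf B' d \<mu>))"
    unfolding B'(1) Pi_pmf_insert'[OF B'(3,2)] map_pmf_def ..
  have prob_y: "measure_pmf.prob (map_pmf (\<lambda>f. f(i := y)) (Pi_pmf B' d \<mu>)) {X. (\<Sum>i\<in>B. a i * X i) = x}
    = measure_pmf.prob (Pi_pmf B' d \<mu>) {f. (\<Sum>j\<in>B'. a j * f j) = x - a i * y}" for y
    by (simp add: vimage_def coeff_split del: fun_upd_apply) (simp add: eq_diff_eq add.commute)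
  have IH: "measure_pmf.prob (Pi_pmf B' d \<mu>) {f. (\<Sum>j\<in>B'. a j * f j) = z} \<le> (1 - e) ^ n" for z
    using Suc.hyps(1)[of B' z] Suc.prems B' by (auto simp: inj_on_insert)
  have "measure_pmf.prob (Pi_pmf B d \<mu>) {X. (\<Sum>i\<in>B. a i * X i) = x}
    \<le> (1 - e) ^ n * measure_pmf.prob (\<mu> i) G"
    unfolding law
  proof (rule prob_bind_pmf_le)
    fix y assume y: "y \<notin> G"
    have "{f. (\<Sum>j\<in>B'. a j * f j) = x - a i * y} = {}"
    proof (rule equals0I)
      fix f assume f: "f \<in> {f. (\<Sum>j\<in>B'. a j * f j) = x - a i * y}"
      have "(\<Sum>j\<in>B'. a j * f j) \<in> ideal_pow p (Suc k)"
        by (intro is_ideal_sum[OF is_ideal_pow] is_idealD(5)[OF is_ideal_pow] above)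
      then have "x - a i * y \<in> ideal_pow p (Suc k)" using f by (simp del: ideal_pow.simps)
      from is_idealD(3)[OF is_ideal_pow this] show False
        using y unfolding G_def by (simp del: ideal_pow.simps)
    qed
    then show "measure_pmf.prob (map_pmf (\<lambda>f. f(i := y)) (Pi_pmf B' d \<mu>)) {X. (\<Sum>i\<in>B. a i * X i) = x} = 0"
      unfolding prob_y by simp
  qed (use IH prob_y e in auto)
  also have "\<dots> \<le> (1 - e) ^ n * (1 - e)"
  proof (intro mult_left_mono)
    show "measure_pmf.prob (\<mu> i) G \<le> 1 - e"
    proof (cases "G = {}")
      case True
      then show ?thesis using e by simp
    next
      case False
      then obtain y0 where y0: "y0 \<in> G" by blast
      have "G \<subseteq> {y. y - y0 \<in> p}"
      proof
        fix y assume "y \<in> G"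
        then have "(a i * y - x) - (a i * y0 - x) \<in> ideal_pow p (Suc k)"
          using y0 is_idealD(6)[OF is_ideal_pow] unfolding G_def by blast
        then have "a i * (y - y0) \<in> ideal_pow p (k + 1)"
          by (simp add: right_diff_distrib del: ideal_pow.simps)
        then have "y - y0 \<in> ideal_pow p 1"
          using pow_cancel[of "a i" k "y - y0" 1] val[OF Suc.prems(3)[OF i(1)]] unfolding k_def by blast
        then show "y \<in> {y. y - y0 \<in> p}" unfolding pow_one by simp
      qed
      then have "measure_pmf.prob (\<mu> i) G \<le> measure_pmf.prob (\<mu> i) {y. y - y0 \<in> p}"
        by (intro measure_pmf.finite_measure_mono) auto
      also have "\<dots> \<le> 1 - e"
      proof -
        have "p \<noteq> UNIV" using one_notin by blast
        then show ?thesis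
          using Suc.prems(4)[OF i(1)] ideal_add_subgroup[OF ideal] unfolding quot_balanced_def by blast
      qed
      finally show ?thesis .
    qed
  qed (use e in auto)
  finally show ?case using Suc.hyps(2) by (metis power_Suc2)
qed

text \<open>After scaling by \<open>t ^ k\<close> and cancelling \<open>w ^ k\<close>, the
  coefficients become elements \<open>y i\<close> outside \<open>p\<close>. The products of the
  \<open>y i\<close> with the variables are still balanced modulo \<open>p^m\<close>, so their sum
  is nearly uniform on \<open>T/p^m\<close>.\<close>

lemma prob_linear_form_same_val:
  fixes \<epsilon> :: "'a set \<Rightarrow> real"
  assumes res: "finite_residues TYPE('a)" and eps: "\<forall>I\<in>Ical. \<epsilon> I > 0" and delta: "0 < \<delta>"
  shows "\<exists>s. \<forall>B (a :: 'i \<Rightarrow> 'a) \<mu> d x k. finite B \<and> s \<le> card B \<and>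
      (\<forall>i\<in>B. a i \<noteq> 0 \<and> val (a i) = k \<and> eps_balanced \<epsilon> (\<mu> i)) \<longrightarrow>
    measure_pmf.prob (Pi_pmf B d \<mu>) {X. (\<Sum>i\<in>B. a i * X i) = x} \<le> \<delta>"
proof -
  \<comment> \<open>One half of \<delta> pays for the uniform mass on \<open>T/p^m\<close>, the
    other for the deviation from uniformity.\<close>
  obtain m0 where m0: "inverse (real (Suc m0)) < \<delta> / 2"
    using reals_Archimedean[of "\<delta> / 2"] delta by auto
  define m where "m = Suc m0"
  obtain e where e: "0 < e" "e < 1" "\<And>\<nu>. eps_balanced \<epsilon> \<nu> \<Longrightarrow> quot_balanced (ideal_pow p m) e \<nu>"
    using quot_balanced_pow[OF res eps, of m] by (auto simp: m_def)
  have "finite (quot (ideal_pow p m))"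
    using pow_subset pow_nonzero by (intro finite_quot[OF res is_ideal_pow]) (auto simp: m_def simp del: ideal_pow.simps)
  then obtain R where "finite_index_subgroup (ideal_pow p m) R"
    using exists_transversal[OF is_ideal_pow] by blast
  then interpret finite_index_subgroup "ideal_pow p m" R .
  have "m < card R" using card_transversal_pow finite_index_subgroup_axioms by blast
  then have "1 / card R \<le> inverse (real (Suc m0))"
    by (simp add: m_def inverse_eq_divide frac_le)
  then have R: "1 / card R + \<delta> / 2 \<le> \<delta>" using m0 by linarith
  obtain s where s: "\<And>L z. \<forall>\<nu>\<in>set L. quot_balanced (ideal_pow p m) e \<nu> \<Longrightarrow> s \<le> length L \<Longrightarrow>
      cprob (sum_law L) z \<le> 1 / card R + \<delta> / 2"
    using cprob_sum_law_eventually[of e "\<delta> / 2"] e(1,2) delta by auto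
  have "measure_pmf.prob (Pi_pmf B d \<mu>) {X. (\<Sum>i\<in>B. a i * X i) = x} \<le> \<delta>"
    if B: "finite B" "s \<le> card B" "\<forall>i\<in>B. a i \<noteq> 0 \<and> val (a i) = k \<and> eps_balanced \<epsilon> (\<mu> i)"
    for B and a :: "'i \<Rightarrow> 'a" and \<mu> d x k
  proof (cases "{X. (\<Sum>i\<in>B. a i * X i) = x} = {}")
    case True
    show ?thesis unfolding True using delta by simp
  next
    case False
    \<comment> \<open>A particular solution supplies the target \<open>z\<close> of the rescaled
      form, so that \<open>x\<close> itself never has to be divided by \<open>w ^ k\<close>.\<close>
    then obtain X0 where X0: "(\<Sum>i\<in>B. a i * X0 i) = x" by blast
    have "\<exists>y. y \<notin> p \<and> t ^ k * a i = w ^ k * y" if "i \<in> B" for i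
      using unit_part[of "a i" k] val[of "a i"] B(3) that by auto
    then obtain y where y: "\<And>i. i \<in> B \<Longrightarrow> y i \<notin> p" "\<And>i. i \<in> B \<Longrightarrow> t ^ k * a i = w ^ k * y i"
      by metis
    have scale: "t ^ k * (\<Sum>i\<in>B. a i * X i) = w ^ k * (\<Sum>i\<in>B. y i * X i)" for X
      unfolding sum_distrib_left by (intro sum.cong refl) (simp add: y(2) flip: mult.assoc)
    define z where "z = (\<Sum>i\<in>B. y i * X0 i)"
    obtain xs where xs: "distinct xs" "set xs = B" using finite_distinct_list[OF B(1)] by blast
    have "{X. (\<Sum>i\<in>B. a i * X i) = x} \<subseteq> {X. (\<Sum>i\<in>B. y i * X i) - z \<in> ideal_pow p m}"
    proof
      fix X assume "X \<in> {X. (\<Sum>i\<in>B. a i * X i) = x}"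
      then have "w ^ k * (\<Sum>i\<in>B. y i * X i) = w ^ k * z"
        using scale[of X] scale[of X0] X0 by (simp add: z_def)
      then have "(\<Sum>i\<in>B. y i * X i) = z" using w_nonzero by simp
      then show "X \<in> {X. (\<Sum>i\<in>B. y i * X i) - z \<in> ideal_pow p m}"
        using is_idealD(1)[OF is_ideal_pow] by simp
    qed
    then have "measure_pmf.prob (Pi_pmf B d \<mu>) {X. (\<Sum>i\<in>B. a i * X i) = x}
      \<le> measure_pmf.prob (Pi_pmf B d \<mu>) {X. (\<Sum>i\<in>B. y i * X i) - z \<in> ideal_pow p m}"
      by (intro measure_pmf.finite_measure_mono) auto
    also have "\<dots> = cprob (map_pmf (\<lambda>X. \<Sum>i\<in>B. y i * X i) (Pi_pmf B d \<mu>)) z"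
      by (simp add: cprob_def vimage_def)
    also have "map_pmf (\<lambda>X. \<Sum>i\<in>B. y i * X i) (Pi_pmf B d \<mu>)
      = sum_law (map (\<lambda>i. map_pmf ((*) (y i)) (\<mu> i)) xs)"
      using sum_law_Pi_pmf[OF xs(1), of "\<lambda>i. (*) (y i)" d \<mu>] unfolding xs(2) .
    also have "cprob \<dots> z \<le> 1 / card R + \<delta> / 2"
    proof (rule s)
      show "\<forall>\<nu>\<in>set (map (\<lambda>i. map_pmf ((*) (y i)) (\<mu> i)) xs). quot_balanced (ideal_pow p m) e \<nu>"
        using e B(3) y(1) xs(2) by (auto intro!: quot_balanced_unit_mult)
      show "s \<le> length (map (\<lambda>i. map_pmf ((*) (y i)) (\<mu> i)) xs)"
        using B(2) xs by (simp flip: distinct_card)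
    qed
    finally show ?thesis using R by linarith
  qed
  then show ?thesis by (intro exI[of _ s] allI impI) (elim conjE)
qed

text \<open>Either the coefficients take many valuations, and reducing modulo successive powers of \<open>p\<close>
  costs a factor \<open>1 - e\<close> for each of them, or one valuation occurs many times, and the
  corresponding partial sum equidistributes modulo a high power of \<open>p\<close>.\<close>
lemma anticoncentration:
  fixes \<epsilon> :: "'a set \<Rightarrow> real"
  assumes res: "finite_residues TYPE('a)" and eps: "\<forall>I\<in>Ical. \<epsilon> I > 0" and delta: "0 < \<delta>"
  shows "\<exists>s. \<forall>A (a :: 'i \<Rightarrow> 'a) \<mu> d x. finite A \<and> s \<le> card A \<and>
      (\<forall>i\<in>A. a i \<noteq> 0 \<and> eps_balanced \<epsilon> (\<mu> i)) \<longrightarrow>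
    measure_pmf.prob (Pi_pmf A d \<mu>) {X. (\<Sum>i\<in>A. a i * X i) = x} \<le> \<delta>"
proof -
  obtain e where e: "0 < e" "e < 1" "\<And>\<nu>. eps_balanced \<epsilon> \<nu> \<Longrightarrow> quot_balanced p e \<nu>"
    using quot_balanced_pow[OF res eps, of 1] unfolding pow_one by auto
  obtain L where L: "(1 - e) ^ L < \<delta>"
    using real_arch_pow_inv[of \<delta> "1 - e"] delta e by auto
  from prob_linear_form_same_val[OF assms] obtain s where s: "\<forall>B (a :: 'i \<Rightarrow> 'a) \<mu> d x k. finite B \<and> s \<le> card B \<and>
      (\<forall>i\<in>B. a i \<noteq> 0 \<and> val (a i) = k \<and> eps_balanced \<epsilon> (\<mu> i)) \<longrightarrow>
    measure_pmf.prob (Pi_pmf B d \<mu>) {X. (\<Sum>i\<in>B. a i * X i) = x} \<le> \<delta>" ..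
  have "measure_pmf.prob (Pi_pmf A d \<mu>) {X. (\<Sum>i\<in>A. a i * X i) = x} \<le> \<delta>"
    if A: "finite A" "Suc (L * s) \<le> card A" "\<And>i. i \<in> A \<Longrightarrow> a i \<noteq> 0" "\<And>i. i \<in> A \<Longrightarrow> eps_balanced \<epsilon> (\<mu> i)"
    for A and a :: "'i \<Rightarrow> 'a" and \<mu> d x
  proof (cases "L \<le> card ((\<lambda>i. val (a i)) ` A)")
    case True
    then obtain V where V: "V \<subseteq> (\<lambda>i. val (a i)) ` A" "card V = L"
      by (meson obtain_subset_with_card_n)
    then obtain B where B: "B \<subseteq> A" "inj_on (\<lambda>i. val (a i)) B" "V = (\<lambda>i. val (a i)) ` B"
      unfolding subset_image_inj by blast
    have finB: "finite B" using B(1) A(1) finite_subset by blast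
    have cardB: "card B = L" using B V(2) by (simp add: card_image)
    show ?thesis
    proof (rule prob_linear_form_subset[OF A(1) B(1)])
      show "measure_pmf.prob (Pi_pmf B d \<mu>) {X. (\<Sum>i\<in>B. a i * X i) = x} \<le> \<delta>" for x
        using prob_linear_form_distinct_val[OF finB B(2), of e \<mu> d x] A(3,4) B(1) e L cardB by force
    qed (use delta in simp)
  next
    case False
    \<comment> \<open>Pigeonhole: fewer than \<open>L\<close> valuations, each occurring at most
      \<open>s\<close> times, account for at most \<open>L * s\<close> indices; hence the
      requirement \<open>Suc (L * s)\<close>.\<close>
    have "\<exists>k. s \<le> card {i\<in>A. val (a i) = k}"
    proof (rule ccontr)
      assume "\<not> ?thesis"
      then have small: "card {i\<in>A. val (a i) = k} \<le> s" for k by (meson linear)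
      have "card A = (\<Sum>k\<in>(\<lambda>i. val (a i)) ` A. card {i\<in>A. val (a i) = k})"
        using sum.image_gen[OF A(1), of "\<lambda>_. 1::nat" "\<lambda>i. val (a i)"] by simp
      also have "\<dots> \<le> card ((\<lambda>i. val (a i)) ` A) * s"
        using sum_bounded_above[of "(\<lambda>i. val (a i)) ` A" _ s] small by simp
      also have "\<dots> \<le> L * s" using False by (intro mult_right_mono) auto
      finally show False using A(2) by simp
    qed
    then obtain k where k: "s \<le> card {i\<in>A. val (a i) = k}" by blast
    show ?thesis
    proof (rule prob_linear_form_subset[OF A(1), of "{i\<in>A. val (a i) = k}"])
      show "measure_pmf.prob (Pi_pmf {i\<in>A. val (a i) = k} d \<mu>)
          {X. (\<Sum>i\<in>{i\<in>A. val (a i) = k}. a i * X i) = x} \<le> \<delta>" for x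
        using A k by (intro s[rule_format, of _ _ k]) auto
    qed (use delta in auto)
  qed
  then show ?thesis by (intro exI[of _ "Suc (L * s)"] allI impI) (elim conjE, simp)
qed

lemma atom_le:
  assumes "quot_balanced p e \<nu>"
  shows "pmf \<nu> x \<le> 1 - e"
proof -
  have "pmf \<nu> x = measure_pmf.prob \<nu> {x}" by (simp add: measure_pmf_single)
  also have "\<dots> \<le> measure_pmf.prob \<nu> {t. t - x \<in> p}"
    using is_idealD(1)[OF ideal] by (intro measure_pmf.finite_measure_mono) auto
  also have "\<dots> \<le> 1 - e"
  proof -
    have "p \<noteq> UNIV" using one_notin by blast
    then show ?thesis
      using assms ideal_add_subgroup[OF ideal] unfolding quot_balanced_def by blast
  qed
  finally show ?thesis .
qed

end

section \<open>Finiteness of the completed cokernel\<close>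

lemma compatible_seq_diff_mem:
  assumes x: "compatible_seq p x" and anti: "\<And>i j. i \<le> j \<Longrightarrow> ideal_pow p j \<subseteq> ideal_pow p i"
    and "j \<le> m"
  shows "x m - x j \<in> ideal_pow p j"
  using \<open>j \<le> m\<close>
proof (induction m rule: dec_induct)
  case base
  show ?case using is_idealD(1)[OF is_ideal_pow] by simp
next
  case (step m)
  have "x (Suc m) - x m \<in> ideal_pow p j"
    using x anti[OF step.hyps(1)] unfolding compatible_seq_def by blast
  from is_idealD(2)[OF is_ideal_pow this step.IH] show ?case by simp
qed

lemma compatible_seq_linear:
  assumes "\<And>i. i \<in> A \<Longrightarrow> compatible_seq p (f i)"
  shows "compatible_seq p (\<lambda>m. \<Sum>i\<in>A. a i * f i m)"
  unfolding compatible_seq_def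
proof
  fix m
  have "(\<Sum>i\<in>A. a i * f i (Suc m)) - (\<Sum>i\<in>A. a i * f i m) = (\<Sum>i\<in>A. a i * (f i (Suc m) - f i m))"
    by (simp add: sum_subtractf right_diff_distrib)
  also have "\<dots> \<in> ideal_pow p m"
    using assms by (intro is_ideal_sum[OF is_ideal_pow] is_idealD(4)[OF is_ideal_pow])
      (auto simp: compatible_seq_def)
  finally show "(\<Sum>i\<in>A. a i * f i (Suc m)) - (\<Sum>i\<in>A. a i * f i m) \<in> ideal_pow p m" .
qed

lemma compatible_seq_diff:
  assumes "compatible_seq p x" "compatible_seq p y"
  shows "compatible_seq p (\<lambda>m. x m - y m)"
  unfolding compatible_seq_def
proof
  fix m
  have "(x (Suc m) - x m) - (y (Suc m) - y m) \<in> ideal_pow p m"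
    by (rule is_idealD(6)[OF is_ideal_pow]) (use assms in \<open>auto simp: compatible_seq_def\<close>)
  then show "x (Suc m) - y (Suc m) - (x m - y m) \<in> ideal_pow p m" by (simp add: algebra_simps)
qed

text \<open>In the completion, everything that vanishes to an order above \<open>val d\<close> is a
  multiple of \<open>d\<close>, since \<open>d\<close> generates a power of the maximal
  ideal.\<close>

lemma (in uniformized_prime) compatible_seq_divide:
  assumes d: "d \<noteq> 0" and x: "compatible_seq p x" and xK: "x (Suc (val d)) \<in> ideal_pow p (Suc (val d))"
  shows "\<exists>y. compatible_seq p y \<and> (\<forall>m. x m - d * y m \<in> ideal_pow p m)"
proof -
  define K where "K = val d"
  note dK = val(1)[OF d, folded K_def] val(2)[OF d, folded K_def]
  have step: "x m - x j \<in> ideal_pow p j" if "j \<le> m" for j m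
    using compatible_seq_diff_mem[OF x pow_antimono that] .
  have mem: "x (m + K) \<in> ideal_pow p K" for m
  proof -
    have "x (Suc K) \<in> ideal_pow p K"
      using xK pow_antimono[of K "Suc K"] unfolding K_def by auto
    moreover have "x (m + K) - x K \<in> ideal_pow p K" "x (Suc K) - x K \<in> ideal_pow p K"
      by (auto intro: step)
    ultimately have "(x (m + K) - x K) - (x (Suc K) - x K) + x (Suc K) \<in> ideal_pow p K"
      by (blast intro: is_idealD(2,6)[OF is_ideal_pow])
    then show ?thesis by simp
  qed
  \<comment> \<open>Dividing by \<open>d\<close> loses \<open>K\<close> digits, so
    \<open>y m\<close> has to be read off from \<open>x (m + K)\<close> to be correct modulo
    \<open>p^m\<close>.\<close>
  have "\<exists>y. d * y - x (m + K) \<in> ideal_pow p (m + K)" for m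
    by (rule pow_subset_multiples[OF dK mem])
  then obtain y where y: "\<And>m. d * y m - x (m + K) \<in> ideal_pow p (m + K)" by metis
  have "y (Suc m) - y m \<in> ideal_pow p m" for m
  proof (rule pow_cancel[OF dK])
    have "d * y (Suc m) - x (Suc m + K) \<in> ideal_pow p (m + K)"
      using y[of "Suc m"] pow_antimono[of "m + K" "Suc m + K"] by auto
    moreover have "x (Suc m + K) - x (m + K) \<in> ideal_pow p (m + K)" by (rule step) simp
    ultimately have "(d * y (Suc m) - x (Suc m + K)) - (d * y m - x (m + K)) + (x (Suc m + K) - x (m + K))
      \<in> ideal_pow p (m + K)"
      using y[of m] by (blast intro: is_idealD(2,6)[OF is_ideal_pow])
    then show "d * (y (Suc m) - y m) \<in> ideal_pow p (K + m)"
      by (simp add: right_diff_distrib add.commute)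
  qed
  moreover have "x m - d * y m \<in> ideal_pow p m" for m
  proof -
    have "d * y m - x (m + K) \<in> ideal_pow p m" using y[of m] pow_antimono[of m "m + K"] by auto
    moreover have "x (m + K) - x m \<in> ideal_pow p m" by (rule step) simp
    ultimately have "- ((d * y m - x (m + K)) + (x (m + K) - x m)) \<in> ideal_pow p m"
      by (blast intro: is_idealD(2,3)[OF is_ideal_pow])
    then show ?thesis by simp
  qed
  ultimately show ?thesis unfolding compatible_seq_def by blast
qed

section \<open>The relation that defines the completed cokernel\<close>

lemma Avec_iff:
  "v \<in> Avec P n \<longleftrightarrow> (\<forall>r<n. \<forall>p\<in>P. compatible_seq p (v r p))
    \<and> (\<forall>r p m. (n \<le> r \<or> p \<notin> P) \<longrightarrow> v r p m = 0)"
  unfolding Avec_def compl_prod_def by (auto simp: fun_eq_iff) (meson not_le)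

lemma cok_tensor_rel_iff:
  "(v, v') \<in> cok_tensor_rel P n u M \<longleftrightarrow> v \<in> Avec P n \<and> v' \<in> Avec P n \<and>
     (\<exists>w\<in>Avec P (n + u). \<forall>r<n. \<forall>p\<in>P. \<forall>m.
        v r p m - v' r p m - (\<Sum>c<n + u. M (r, c) * w c p m) \<in> ideal_pow p m)"
  by (simp add: cok_tensor_rel_def)

lemma Avec_diff:
  assumes "v \<in> Avec P n" "v' \<in> Avec P n"
  shows "(\<lambda>r p m. v r p m - v' r p m) \<in> Avec P n"
  using assms by (auto simp: Avec_iff intro: compatible_seq_diff)

lemma Avec_zero: "(\<lambda>r p m. 0) \<in> Avec P n"
  by (auto simp: Avec_iff compatible_seq_def is_idealD(1)[OF is_ideal_pow])

lemma equiv_cok_tensor_rel: "equiv (Avec P n) (cok_tensor_rel P n u M)"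
proof (rule equivI)
  let ?R = "cok_tensor_rel P n u M"
  show "?R \<subseteq> Avec P n \<times> Avec P n" by (auto simp: cok_tensor_rel_iff)
  have refl: "(v, v) \<in> ?R" if "v \<in> Avec P n" for v
    using that Avec_zero unfolding cok_tensor_rel_iff
    by (intro conjI bexI[of _ "\<lambda>r p m. 0"]) (auto simp: is_idealD(1)[OF is_ideal_pow])
  then show "refl_on (Avec P n) ?R" by (auto simp: refl_on_def)
  \<comment> \<open>Symmetry and transitivity both follow from this form of transitivity.\<close>
  have euclid: "(v2, v3) \<in> ?R" if v: "(v1, v2) \<in> ?R" "(v1, v3) \<in> ?R" for v1 v2 v3
  proof -
    obtain w w' where w: "w \<in> Avec P (n + u)" "w' \<in> Avec P (n + u)"
      and eq: "\<And>r p m. r < n \<Longrightarrow> p \<in> P \<Longrightarrow>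
          v1 r p m - v2 r p m - (\<Sum>c<n + u. M (r, c) * w c p m) \<in> ideal_pow p m"
        "\<And>r p m. r < n \<Longrightarrow> p \<in> P \<Longrightarrow>
          v1 r p m - v3 r p m - (\<Sum>c<n + u. M (r, c) * w' c p m) \<in> ideal_pow p m"
      using v unfolding cok_tensor_rel_iff by blast
    have "v2 r p m - v3 r p m - (\<Sum>c<n + u. M (r, c) * (w' c p m - w c p m)) \<in> ideal_pow p m"
      if "r < n" "p \<in> P" for r p m
      using is_idealD(6)[OF is_ideal_pow eq(2)[OF that, of m] eq(1)[OF that, of m]]
      by (simp add: right_diff_distrib sum_subtractf algebra_simps)
    then show ?thesis
      using v Avec_diff[OF w(2,1)] unfolding cok_tensor_rel_iff
      by (intro conjI bexI[of _ "\<lambda>r p m. w' r p m - w r p m"] allI impI ballI) auto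
  qed
  have sym: "(v', v) \<in> ?R" if vv: "(v, v') \<in> ?R" for v v'
    using euclid[OF vv refl] vv by (auto simp: cok_tensor_rel_iff)
  then show "sym ?R" by (rule symI)
  show "trans ?R"
  proof (rule transI)
    fix x y z assume "(x, y) \<in> ?R" "(y, z) \<in> ?R"
    then show "(x, z) \<in> ?R" using euclid[OF sym] by blast
  qed
qed

lemma finite_quotient_of_invariant:
  assumes equiv: "equiv A R" and fin: "finite (f ` A)"
    and f: "\<And>x y. x \<in> A \<Longrightarrow> y \<in> A \<Longrightarrow> f x = f y \<Longrightarrow> (x, y) \<in> R"
  shows "finite (A // R)"
proof -
  define h where "h s = R `` {SOME x. x \<in> A \<and> f x = s}" for s
  have "A // R \<subseteq> h ` f ` A"
  proof
    fix X assume "X \<in> A // R"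
    then obtain x where x: "x \<in> A" "X = R `` {x}" by (auto elim: quotientE)
    define y where "y = (SOME y. y \<in> A \<and> f y = f x)"
    have "y \<in> A \<and> f y = f x" unfolding y_def by (rule someI[of _ x]) (use x in simp)
    then have "(x, y) \<in> R" using f x by auto
    then have "X = h (f x)" using x(2) equiv_class_eq[OF equiv] by (simp add: h_def y_def)
    then show "X \<in> h ` f ` A" using x(1) by blast
  qed
  then show ?thesis using fin by (meson finite_imageI finite_subset)
qed

text \<open>\<open>M N = D\<close> shows that \<open>D\<close> annihilates the cokernel: a
  difference \<open>D y\<close> is the image of \<open>N y\<close>. A class is therefore determined
  by the residues of its coordinates modulo high enough powers of the finitely many primes.\<close>

lemma finite_cok_tensor:
  fixes M :: "nat \<times> nat \<Rightarrow> 'a::idom"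
  assumes res: "finite_residues TYPE('a)" and P: "finite P"
    and uni: "\<And>p. p \<in> P \<Longrightarrow> \<exists>w t. uniformized_prime p w t" and D: "D \<noteq> 0"
    and N: "\<And>r r'. r < n \<Longrightarrow> r' < n \<Longrightarrow> (\<Sum>c<n + u. M (r, c) * N c r') = (if r = r' then D else 0)"
  shows "finite (cok_tensor P n u M)"
proof -
  have "\<exists>K. finite (quot (ideal_pow p K)) \<and> (\<forall>x. compatible_seq p x \<longrightarrow> x K \<in> ideal_pow p K \<longrightarrow>
      (\<exists>y. compatible_seq p y \<and> (\<forall>m. x m - D * y m \<in> ideal_pow p m)))" if p: "p \<in> P" for p
  proof -
    obtain w t where "uniformized_prime p w t" using uni[OF p] by blast
    then interpret uniformized_prime p w t .
    have "finite (quot (ideal_pow p (Suc (val D))))"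
      by (intro finite_quot[OF res is_ideal_pow] pow_nonzero pow_subset) simp
    then show ?thesis using compatible_seq_divide[OF D] by blast
  qed
  then obtain K where K: "\<And>p. p \<in> P \<Longrightarrow> finite (quot (ideal_pow p (K p)))"
    and div: "\<And>p x. p \<in> P \<Longrightarrow> compatible_seq p x \<Longrightarrow> x (K p) \<in> ideal_pow p (K p) \<Longrightarrow>
      \<exists>y. compatible_seq p y \<and> (\<forall>m. x m - D * y m \<in> ideal_pow p m)"
    by metis
  \<comment> \<open>Reduction of every coordinate modulo \<open>p^(K p)\<close>, where
    \<open>K p\<close> is large enough for differences that vanish there to be divisible by
    \<open>D\<close>; the restriction puts all values into one finite \<open>PiE\<close>.\<close>
  define f where "f v = restrict (\<lambda>(r, p). ideal_rel (ideal_pow p (K p)) `` {v r p (K p)}) ({..<n} \<times> P)"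
    for v :: "nat \<Rightarrow> 'a set \<Rightarrow> nat \<Rightarrow> 'a"
  show ?thesis
    unfolding cok_tensor_def
  proof (rule finite_quotient_of_invariant[OF equiv_cok_tensor_rel, of f])
    have "f ` Avec P n \<subseteq> PiE ({..<n} \<times> P) (\<lambda>(r, p). quot (ideal_pow p (K p)))"
      unfolding f_def by (intro image_subsetI restrict_PiE[THEN iffD2]) (auto simp: quot_eq_image)
    moreover have "finite (PiE ({..<n} \<times> P) (\<lambda>(r, p). quot (ideal_pow p (K p))))"
      using P K by (intro finite_PiE) auto
    ultimately show "finite (f ` Avec P n)" by (rule finite_subset)
  next
    fix v v' assume v: "v \<in> Avec P n" "v' \<in> Avec P n" "f v = f v'"
    have "\<exists>y. compatible_seq p y \<and> (\<forall>m. v r p m - v' r p m - D * y m \<in> ideal_pow p m)"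
      if rp: "r < n" "p \<in> P" for r p
    proof (rule div[OF rp(2)])
      show "compatible_seq p (\<lambda>m. v r p m - v' r p m)"
        using v rp by (intro compatible_seq_diff) (auto simp: Avec_iff)
      have "ideal_rel (ideal_pow p (K p)) `` {v r p (K p)} = ideal_rel (ideal_pow p (K p)) `` {v' r p (K p)}"
        using fun_cong[OF v(3), of "(r, p)"] rp by (simp add: f_def)
      then show "v r p (K p) - v' r p (K p) \<in> ideal_pow p (K p)"
        by (simp add: ideal_class_eq_iff[OF is_ideal_pow])
    qed
    then obtain y where y: "\<And>r p. r < n \<Longrightarrow> p \<in> P \<Longrightarrow> compatible_seq p (y r p)"
      "\<And>r p m. r < n \<Longrightarrow> p \<in> P \<Longrightarrow> v r p m - v' r p m - D * y r p m \<in> ideal_pow p m"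
      by metis
    define w where "w c p m = (if c < n + u \<and> p \<in> P then \<Sum>r<n. N c r * y r p m else 0)" for c p m
    have wA: "w \<in> Avec P (n + u)"
    proof -
      have "compatible_seq p (w c p)" if "c < n + u" "p \<in> P" for c p
      proof -
        have "w c p = (\<lambda>m. \<Sum>r<n. N c r * y r p m)" using that by (auto simp: w_def)
        moreover have "compatible_seq p (\<lambda>m. \<Sum>r<n. N c r * y r p m)"
          using y(1) that by (intro compatible_seq_linear) auto
        ultimately show ?thesis by simp
      qed
      then show ?thesis by (auto simp: Avec_iff w_def)
    qed
    have Mw: "(\<Sum>c<n + u. M (r, c) * w c p m) = D * y r p m" if rp: "r < n" "p \<in> P" for r p m
    proof -
      have "(\<Sum>c<n + u. M (r, c) * w c p m) = (\<Sum>c<n + u. \<Sum>r'<n. M (r, c) * N c r' * y r' p m)"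
        using rp by (intro sum.cong) (auto simp: w_def sum_distrib_left mult.assoc)
      also have "\<dots> = (\<Sum>r'<n. \<Sum>c<n + u. M (r, c) * N c r' * y r' p m)" by (rule sum.swap)
      also have "\<dots> = (\<Sum>r'<n. (if r = r' then D else 0) * y r' p m)"
        using N rp by (intro sum.cong) (auto simp flip: sum_distrib_right)
      also have "\<dots> = D * y r p m"
        using rp by (simp add: if_distrib[of "\<lambda>z. z * _"] cong: if_cong)
      finally show ?thesis .
    qed
    show "(v, v') \<in> cok_tensor_rel P n u M"
      unfolding cok_tensor_rel_iff using v wA y(2) Mw by (auto intro!: bexI[of _ w])
  qed
qed

text \<open>A substitute for the adjugate matrix. The forms \<open>F\<close> make the first
  \<open>n\<close> columns independent; each unit vector together with them is \<open>n + 1\<close>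
  vectors in \<open>n\<close> coordinates, so some nonzero multiple of it is a combination of
  columns.\<close>

lemma exists_scalar_right_inverse:
  fixes M :: "nat \<times> nat \<Rightarrow> 'a::idom"
  assumes flag: "\<And>j. j < n \<Longrightarrow> \<exists>F. (\<forall>c<j. (\<Sum>i<n. F i * M (i, c)) = 0) \<and> (\<Sum>i<n. F i * M (i, j)) \<noteq> 0"
  shows "\<exists>D N. D \<noteq> 0 \<and>
    (\<forall>r<n. \<forall>r'<n. (\<Sum>c<n + u. M (r, c) * N c r') = (if r = r' then D else 0))"
proof -
  have indep: "\<forall>c<n. x c = 0" if x: "\<And>r. r < n \<Longrightarrow> (\<Sum>c<n. x c * M (r, c)) = 0" for x
  proof (rule ccontr)
    assume "\<not> ?thesis"
    then obtain c0 where c0: "c0 < n \<and> x c0 \<noteq> 0" by blast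
    \<comment> \<open>With \<open>j\<close> the last column that occurs in the relation, the form
      \<open>F\<close> for \<open>j\<close> kills all other terms.\<close>
    obtain j where j: "j < n" "x j \<noteq> 0" "\<And>c. c < n \<Longrightarrow> x c \<noteq> 0 \<Longrightarrow> c \<le> j"
      using ex_has_greatest_nat[of "\<lambda>c. c < n \<and> x c \<noteq> 0" c0 "\<lambda>c. c" n, OF c0] by blast
    obtain F where F: "\<And>c. c < j \<Longrightarrow> (\<Sum>i<n. F i * M (i, c)) = 0" "(\<Sum>i<n. F i * M (i, j)) \<noteq> 0"
      using flag[OF j(1)] by blast
    have "0 = (\<Sum>i<n. F i * (\<Sum>c<n. x c * M (i, c)))" using x by simp
    also have "\<dots> = (\<Sum>c<n. x c * (\<Sum>i<n. F i * M (i, c)))"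
      unfolding sum_distrib_left by (subst sum.swap) (simp add: mult.left_commute)
    also have "\<dots> = (\<Sum>c\<in>{j}. x c * (\<Sum>i<n. F i * M (i, c)))"
    proof (rule sum.mono_neutral_right)
      show "\<forall>c\<in>{..<n} - {j}. x c * (\<Sum>i<n. F i * M (i, c)) = 0"
      proof
        fix c assume c: "c \<in> {..<n} - {j}"
        then show "x c * (\<Sum>i<n. F i * M (i, c)) = 0"
          using j(3)[of c] F(1)[of c] by (cases "x c = 0") auto
      qed
    qed (use j(1) in auto)
    finally show False using j(2) F(2) by simp
  qed
  have "\<exists>d y. d \<noteq> 0 \<and> (\<forall>r<n. (\<Sum>c<n. M (r, c) * y c) = (if r = r' then d else 0))" if "r' < n" for r'
  proof -
    \<comment> \<open>The columns have indices below \<open>n\<close>, and the unit vector of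
      \<open>r'\<close> has index \<open>n\<close>.\<close>
    define v where "v s r = (if s < n then M (r, s) else if r = r' then 1 else 0)" for s r
    obtain x where x: "\<exists>s\<in>{..n}. x s \<noteq> 0" "\<forall>r\<in>{..<n}. (\<Sum>s\<in>{..n}. x s * v s r) = 0"
      using dependent_of_card_gt[of "{..<n}" "{..n}" v] by auto
    have eq: "(\<Sum>c<n. x c * M (r, c)) + (if r = r' then x n else 0) = 0" if "r < n" for r
      using bspec[OF x(2), of r] that by (auto simp: v_def simp flip: lessThan_Suc_atMost)
    have "x n \<noteq> 0"
    proof
      assume xn: "x n = 0"
      have "(\<Sum>c<n. x c * M (r, c)) = 0" if "r < n" for r
        using eq[OF that] xn by (simp split: if_splits)
      then have "\<forall>c<n. x c = 0" by (rule indep)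
      then show False using x(1) xn by (metis atMost_iff le_neq_implies_less)
    qed
    moreover have "(\<Sum>c<n. M (r, c) * (- x c)) = (if r = r' then x n else 0)" if "r < n" for r
    proof -
      have "(\<Sum>c<n. M (r, c) * (- x c)) = - (\<Sum>c<n. x c * M (r, c))"
        by (simp add: sum_negf mult.commute)
      then show ?thesis using eq[OF that] by (simp only: neg_eq_iff_add_eq_0)
    qed
    ultimately show ?thesis by (intro exI[of _ "x n"] exI[of _ "\<lambda>c. - x c"]) blast
  qed
  then obtain d y where d: "\<And>r'. r' < n \<Longrightarrow> d r' \<noteq> 0"
    and y: "\<And>r r'. r' < n \<Longrightarrow> r < n \<Longrightarrow> (\<Sum>c<n. M (r, c) * y r' c) = (if r = r' then d r' else 0)"
    by metis
  define D where "D = (\<Prod>r<n. d r)"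
  \<comment> \<open>The factors \<open>d r\<close> depend on the unit vector; multiplying by all the
    others brings them to the common value \<open>D\<close>.\<close>
  define N where "N c r' = (if c < n then y r' c * (\<Prod>r\<in>{..<n} - {r'}. d r) else 0)" for c r'
  have "(\<Sum>c<n + u. M (r, c) * N c r') = (if r = r' then D else 0)" if r: "r < n" "r' < n" for r r'
  proof -
    have "(\<Sum>c<n + u. M (r, c) * N c r') = (\<Sum>c<n. M (r, c) * N c r')"
      by (rule sum.mono_neutral_right) (auto simp: N_def)
    also have "\<dots> = (\<Sum>c<n. M (r, c) * y r' c) * (\<Prod>r\<in>{..<n} - {r'}. d r)"
      unfolding sum_distrib_right by (intro sum.cong) (auto simp: N_def)
    also have "\<dots> = (if r = r' then D else 0)"
      using y[OF r(2,1)] prod.remove[of "{..<n}" r' d] r(2) by (simp add: D_def)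
    finally show ?thesis .
  qed
  moreover have "D \<noteq> 0" using d by (simp add: D_def)
  ultimately show ?thesis by blast
qed

section \<open>Columns of random matrices\<close>

text \<open>Stated dually: over the fraction field, column \<open>j\<close> lies in the span of the columns before it.\<close>
definition column_failure :: "nat \<Rightarrow> nat \<Rightarrow> (nat \<times> nat \<Rightarrow> 'a::comm_ring_1) set" where
  "column_failure n j = {M. \<forall>F. (\<forall>c<j. (\<Sum>i<n. F i * M (i, c)) = 0) \<longrightarrow> (\<Sum>i<n. F i * M (i, j)) = 0}"

text \<open>Outside this event, every nonzero form that kills the first \<open>k\<close> columns has
  more than \<open>s\<close> nonzero coefficients, enough for anticoncentration.\<close>

definition sparse_relation :: "nat \<Rightarrow> nat \<Rightarrow> nat \<Rightarrow> (nat \<times> nat \<Rightarrow> 'a::comm_ring_1) set" where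
  "sparse_relation n k s = {M. \<exists>F. (\<exists>i<n. F i \<noteq> 0) \<and> card {i. i < n \<and> F i \<noteq> 0} \<le> s \<and>
     (\<forall>c<k. (\<Sum>i<n. F i * M (i, c)) = 0)}"

lemma sum_column: "(\<Sum>z\<in>{..<n::nat} \<times> {j::nat}. g z) = (\<Sum>i<n. g (i, j))"
  by (simp add: sum.cartesian_product')

lemma sum_row: "(\<Sum>z\<in>{i::nat} \<times> {..<k::nat}. g z) = (\<Sum>c<k. g (i, c))"
  by (simp add: sum.cartesian_product')

lemma prob_Pi_pmf_conditional_subset_le:
  assumes "finite S" "A \<subseteq> S" "0 \<le> c"
    and "\<And>Y. measure_pmf.prob (Pi_pmf A d \<mu>) {X. (\<lambda>i. if i \<in> A then X i else Y i) \<in> E} \<le> c"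
  shows "measure_pmf.prob (Pi_pmf S d \<mu>) E \<le> c"
proof -
  have "measure_pmf.prob (Pi_pmf (A \<union> (S - A)) d \<mu>) E \<le> c"
    using assms by (intro prob_Pi_pmf_conditional_le) (auto intro: finite_subset)
  moreover have "A \<union> (S - A) = S" using assms(2) by blast
  ultimately show ?thesis by simp
qed

text \<open>All columns but \<open>j\<close> are frozen; Odlyzko's bound then applies to
  \<open>n\<close> coordinates and the \<open>j\<close> columns before it.\<close>

lemma prob_column_failure_le:
  fixes \<mu> :: "nat \<times> nat \<Rightarrow> 'a::idom pmf"
  assumes q: "0 \<le> q" "q \<le> 1" and j: "j < m"
    and atoms: "\<And>z x. z \<in> {..<n} \<times> {..<m} \<Longrightarrow> pmf (\<mu> z) x \<le> q"
  shows "measure_pmf.prob (Pi_pmf ({..<n} \<times> {..<m}) d \<mu>) (column_failure n j) \<le> q ^ (n - j)"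
proof (rule prob_Pi_pmf_conditional_subset_le[where A = "{..<n} \<times> {j}"])
  fix Y :: "nat \<times> nat \<Rightarrow> 'a"
  let ?A = "{..<n} \<times> {j}"
  let ?E = "{X. \<forall>F. (\<forall>c\<in>{..<j}. (\<Sum>z\<in>?A. F z * Y (fst z, c)) = 0) \<longrightarrow> (\<Sum>z\<in>?A. F z * X z) = 0}"
  have "{X. (\<lambda>z. if z \<in> ?A then X z else Y z) \<in> column_failure n j} \<subseteq> ?E"
  proof
    fix X assume "X \<in> {X. (\<lambda>z. if z \<in> ?A then X z else Y z) \<in> column_failure n j}"
    then have X: "(\<Sum>i<n. F i * X (i, j)) = 0" if "\<And>c. c < j \<Longrightarrow> (\<Sum>i<n. F i * Y (i, c)) = 0" for F
      using that by (simp add: column_failure_def)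
    have "(\<Sum>z\<in>?A. F z * X z) = 0" if F: "\<forall>c\<in>{..<j}. (\<Sum>z\<in>?A. F z * Y (fst z, c)) = 0" for F
      using X[of "\<lambda>i. F (i, j)"] F by (simp add: sum_column)
    then show "X \<in> ?E" by blast
  qed
  then have "measure_pmf.prob (Pi_pmf ?A d \<mu>) {X. (\<lambda>z. if z \<in> ?A then X z else Y z) \<in> column_failure n j}
    \<le> measure_pmf.prob (Pi_pmf ?A d \<mu>) ?E"
    by (intro measure_pmf.finite_measure_mono) auto
  also have "\<dots> \<le> q ^ (card ?A - card {..<j})"
    using j atoms q by (intro prob_in_subspace_le) auto
  finally show "measure_pmf.prob (Pi_pmf ?A d \<mu>)
      {X. (\<lambda>z. if z \<in> ?A then X z else Y z) \<in> column_failure n j} \<le> q ^ (n - j)"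
    by simp
qed (use q j in auto)

lemma card_small_subsets_le:
  assumes "0 < n"
  shows "card {R. R \<subseteq> {..<n::nat} \<and> card R \<le> s} \<le> Suc s * n ^ s"
proof -
  have "{R. R \<subseteq> {..<n} \<and> card R \<le> s} = (\<Union>k\<in>{..s}. {R. R \<subseteq> {..<n} \<and> card R = k})" by auto
  then have "card {R. R \<subseteq> {..<n} \<and> card R \<le> s} \<le> (\<Sum>k\<in>{..s}. card {R. R \<subseteq> {..<n} \<and> card R = k})"
    by (simp only: card_UN_le finite_atMost)
  also have "\<dots> = (\<Sum>k\<in>{..s}. n choose k)" by (simp add: n_subsets)
  also have "\<dots> \<le> (\<Sum>k\<in>{..s}. n ^ s)"
  proof (rule sum_mono)
    fix k assume k: "k \<in> {..s}"
    have "n choose k \<le> n ^ k" by (cases "k \<le> n") (auto simp: binomial_le_pow binomial_eq_0)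
    also have "\<dots> \<le> n ^ s" using k assms by (intro power_increasing) auto
    finally show "n choose k \<le> n ^ s" .
  qed
  finally show ?thesis by simp
qed

text \<open>If \<open>i\<close> is in the support of the relation and \<open>R\<close> is the rest
  of the support, then row \<open>i\<close>, cut to \<open>k\<close> entries, lies in the span of at
  most \<open>s\<close> other rows, which has probability at most \<open>q ^ (k - s)\<close>. The
  remaining factor counts the pairs \<open>(i, R)\<close>.\<close>

lemma prob_sparse_relation_le:
  fixes \<mu> :: "nat \<times> nat \<Rightarrow> 'a::idom pmf"
  assumes q: "0 \<le> q" "q \<le> 1" and k: "k \<le> m" and n: "0 < n"
    and atoms: "\<And>z x. z \<in> {..<n} \<times> {..<m} \<Longrightarrow> pmf (\<mu> z) x \<le> q"
  shows "measure_pmf.prob (Pi_pmf ({..<n} \<times> {..<m}) d \<mu>) (sparse_relation n k s)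
    \<le> real (Suc s) * real n ^ Suc s * q ^ (k - s)"
proof -
  let ?law = "Pi_pmf ({..<n} \<times> {..<m}) d \<mu>"
  define T where "T i R = {M :: nat \<times> nat \<Rightarrow> 'a.
    \<forall>G. (\<forall>r\<in>R. (\<Sum>c<k. G c * M (r, c)) = 0) \<longrightarrow> (\<Sum>c<k. G c * M (i, c)) = 0}" for i R
  define \<R> where "\<R> = {R. R \<subseteq> {..<n} \<and> card R \<le> s}"
  have fin\<R>: "finite \<R>" by (rule finite_subset[of _ "Pow {..<n}"]) (auto simp: \<R>_def)
  define U where "U = {z \<in> {..<n} \<times> \<R>. fst z \<notin> snd z}"
  have finU: "finite U" using fin\<R> by (simp add: U_def)
  have cardU: "card U \<le> Suc s * n ^ Suc s"
  proof -
    have "card U \<le> card ({..<n} \<times> \<R>)" using fin\<R> by (intro card_mono) (auto simp: U_def)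
    also have "\<dots> = n * card \<R>" by (simp add: card_cartesian_product)
    also have "\<dots> \<le> n * (Suc s * n ^ s)"
      using card_small_subsets_le[OF n] by (intro mult_left_mono) (auto simp: \<R>_def)
    finally show ?thesis by (simp add: mult.left_commute)
  qed
  have cover: "sparse_relation n k s \<subseteq> (\<Union>z\<in>U. T (fst z) (snd z))"
  proof
    fix M :: "nat \<times> nat \<Rightarrow> 'a" assume "M \<in> sparse_relation n k s"
    then obtain F i where F: "i < n" "F i \<noteq> 0" "card {i. i < n \<and> F i \<noteq> 0} \<le> s"
      "\<And>c. c < k \<Longrightarrow> (\<Sum>i<n. F i * M (i, c)) = 0"
      unfolding sparse_relation_def by blast
    define R where "R = {i. i < n \<and> F i \<noteq> 0} - {i}"
    have R: "finite R" "i \<notin> R" "{i. i < n \<and> F i \<noteq> 0} = insert i R" using F(1,2) by (auto simp: R_def)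
    have "card R \<le> card {i. i < n \<and> F i \<noteq> 0}" by (intro card_mono) (auto simp: R_def)
    moreover have "R \<subseteq> {..<n}" by (auto simp: R_def)
    ultimately have "(i, R) \<in> U" using F(1,3) R(2) by (simp add: U_def \<R>_def)
    moreover have "M \<in> T i R"
      unfolding T_def
    proof (intro CollectI allI impI)
      fix G assume G: "\<forall>r\<in>R. (\<Sum>c<k. G c * M (r, c)) = 0"
      have "F i * (\<Sum>c<k. G c * M (i, c)) = F i * (\<Sum>c<k. G c * M (i, c)) + (\<Sum>r\<in>R. F r * (\<Sum>c<k. G c * M (r, c)))"
        using G by simp
      also have "\<dots> = (\<Sum>r\<in>{i. i < n \<and> F i \<noteq> 0}. F r * (\<Sum>c<k. G c * M (r, c)))"
        using R by simp
      also have "\<dots> = (\<Sum>r<n. F r * (\<Sum>c<k. G c * M (r, c)))"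
        by (rule sum.mono_neutral_left) auto
      also have "\<dots> = (\<Sum>c<k. G c * (\<Sum>r<n. F r * M (r, c)))"
        unfolding sum_distrib_left by (subst sum.swap) (simp add: mult.left_commute)
      also have "\<dots> = 0" using F(4) by simp
      finally show "(\<Sum>c<k. G c * M (i, c)) = 0" using F(2) by simp
    qed
    ultimately show "M \<in> (\<Union>z\<in>U. T (fst z) (snd z))" by force
  qed
  have T_le: "measure_pmf.prob ?law (T i R) \<le> q ^ (k - s)" if iR: "(i, R) \<in> U" for i R
  proof (rule prob_Pi_pmf_conditional_subset_le[where A = "{i} \<times> {..<k}"])
    fix Y :: "nat \<times> nat \<Rightarrow> 'a"
    let ?A = "{i} \<times> {..<k}"
    have R: "finite R" "card R \<le> s" "i \<notin> R" "i < n"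
      using iR finite_subset[of R "{..<n}"] by (auto simp: U_def \<R>_def)
    let ?E = "{X. \<forall>F. (\<forall>r\<in>R. (\<Sum>z\<in>?A. F z * Y (r, snd z)) = 0) \<longrightarrow> (\<Sum>z\<in>?A. F z * X z) = 0}"
    have "{X. (\<lambda>z. if z \<in> ?A then X z else Y z) \<in> T i R} \<subseteq> ?E"
    proof
      fix X assume X: "X \<in> {X. (\<lambda>z. if z \<in> ?A then X z else Y z) \<in> T i R}"
      have row: "(\<Sum>c<k. G c * (if (r, c) \<in> ?A then X (r, c) else Y (r, c))) = (\<Sum>c<k. G c * Y (r, c))"
        if "r \<in> R" for r G using that R(3) by (intro sum.cong) auto
      have row_i: "(\<Sum>c<k. G c * (if (i, c) \<in> ?A then X (i, c) else Y (i, c))) = (\<Sum>c<k. G c * X (i, c))"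
        for G by (intro sum.cong) auto
      have X': "(\<Sum>c<k. G c * X (i, c)) = 0" if "\<And>r. r \<in> R \<Longrightarrow> (\<Sum>c<k. G c * Y (r, c)) = 0" for G
      proof -
        have "\<forall>r\<in>R. (\<Sum>c<k. G c * (if (r, c) \<in> ?A then X (r, c) else Y (r, c))) = 0"
          using that row by simp
        then show ?thesis using X row_i[of G] unfolding T_def by fastforce
      qed
      have "(\<Sum>z\<in>?A. F z * X z) = 0" if "\<forall>r\<in>R. (\<Sum>z\<in>?A. F z * Y (r, snd z)) = 0" for F
        using X'[of "\<lambda>c. F (i, c)"] that by (simp add: sum_row)
      then show "X \<in> ?E" by blast
    qed
    then have "measure_pmf.prob (Pi_pmf ?A d \<mu>) {X. (\<lambda>z. if z \<in> ?A then X z else Y z) \<in> T i R}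
      \<le> measure_pmf.prob (Pi_pmf ?A d \<mu>) ?E"
      by (intro measure_pmf.finite_measure_mono) auto
    also have "\<dots> \<le> q ^ (card ?A - card R)"
      using k R atoms q by (intro prob_in_subspace_le) auto
    also have "\<dots> \<le> q ^ (k - s)" using R q by (intro power_decreasing) auto
    finally show "measure_pmf.prob (Pi_pmf ?A d \<mu>)
        {X. (\<lambda>z. if z \<in> ?A then X z else Y z) \<in> T i R} \<le> q ^ (k - s)" .
  qed (use q k iR in \<open>auto simp: U_def\<close>)
  have "measure_pmf.prob ?law (sparse_relation n k s) \<le> measure_pmf.prob ?law (\<Union>z\<in>U. T (fst z) (snd z))"
    using cover by (intro measure_pmf.finite_measure_mono) auto
  also have "\<dots> \<le> (\<Sum>z\<in>U. measure_pmf.prob ?law (T (fst z) (snd z)))"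
    using finU by (intro measure_pmf.finite_measure_subadditive_finite) auto
  also have "\<dots> \<le> (\<Sum>z\<in>U. q ^ (k - s))"
    using T_le by (intro sum_mono) auto
  also have "\<dots> = real (card U) * q ^ (k - s)" by simp
  also have "\<dots> \<le> real (Suc s * n ^ Suc s) * q ^ (k - s)"
    using cardU q by (intro mult_right_mono) (auto simp only: of_nat_le_iff zero_le_power)
  also have "real (Suc s * n ^ Suc s) = real (Suc s) * real n ^ Suc s"
    by (simp only: of_nat_mult of_nat_power)
  finally show ?thesis .
qed

text \<open>Failure at \<open>j\<close> makes every form that kills the earlier columns vanish on
  column \<open>j\<close>. One such form, with more than \<open>s\<close> nonzero coefficients,
  already has probability at most \<delta> of doing so.\<close>

lemma prob_column_failure_dense_le:
  fixes \<mu> :: "nat \<times> nat \<Rightarrow> 'a::idom pmf"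
  assumes j: "k \<le> j" "j < n" "n \<le> m" and delta: "0 \<le> \<delta>"
    and anti: "\<And>A a. A \<subseteq> {..<n} \<times> {..<m} \<Longrightarrow> s \<le> card A \<Longrightarrow> (\<And>z. z \<in> A \<Longrightarrow> a z \<noteq> 0) \<Longrightarrow>
      (\<And>x. measure_pmf.prob (Pi_pmf A d \<mu>) {X. (\<Sum>z\<in>A. a z * X z) = x} \<le> \<delta>)"
  shows "measure_pmf.prob (Pi_pmf ({..<n} \<times> {..<m}) d \<mu>) (column_failure n j - sparse_relation n k s) \<le> \<delta>"
proof (rule prob_Pi_pmf_conditional_subset_le[where A = "{..<n} \<times> {j}"])
  fix Y :: "nat \<times> nat \<Rightarrow> 'a"
  let ?A = "{..<n} \<times> {j}"
  let ?E = "{X. (\<lambda>z. if z \<in> ?A then X z else Y z) \<in> column_failure n j - sparse_relation n k s}"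
  obtain F where F: "\<exists>i\<in>{..<n}. F i \<noteq> 0" "\<forall>c\<in>{..<j}. (\<Sum>i<n. F i * Y (i, c)) = 0"
    using dependent_of_card_gt[of "{..<j}" "{..<n}" "\<lambda>i c. Y (i, c)"] j by auto
  show "measure_pmf.prob (Pi_pmf ?A d \<mu>) ?E \<le> \<delta>"
  proof (cases "card {i. i < n \<and> F i \<noteq> 0} \<le> s")
    case True
    \<comment> \<open>As \<open>k \<le> j\<close>, the first \<open>k\<close> columns are all
      frozen, so a sparse \<open>F\<close> puts every completion into the excluded event.\<close>
    have "(\<lambda>z. if z \<in> ?A then X z else Y z) \<in> sparse_relation n k s" for X
      unfolding sparse_relation_def using F True j(1) by (intro CollectI exI[of _ F]) auto
    then have E: "?E = {}" by blast
    show ?thesis unfolding E using delta by simp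
  next
    case False
    define A' where "A' = {z \<in> ?A. F (fst z) \<noteq> 0}"
    have "A' = (\<lambda>i. (i, j)) ` {i. i < n \<and> F i \<noteq> 0}" by (auto simp: A'_def)
    then have "card A' = card {i. i < n \<and> F i \<noteq> 0}" by (simp add: card_image inj_on_def)
    then have cardA': "s \<le> card A'" using False by simp
    have "?E \<subseteq> {X. (\<Sum>z\<in>?A. F (fst z) * X z) = 0}"
    proof
      fix X assume "X \<in> ?E"
      then have "(\<Sum>i<n. F i * X (i, j)) = 0" using F(2) by (simp add: column_failure_def)
      then show "X \<in> {X. (\<Sum>z\<in>?A. F (fst z) * X z) = 0}" by (simp add: sum_column)
    qed
    then have "measure_pmf.prob (Pi_pmf ?A d \<mu>) ?E
      \<le> measure_pmf.prob (Pi_pmf ?A d \<mu>) {X. (\<Sum>z\<in>?A. F (fst z) * X z) = 0}"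
      by (intro measure_pmf.finite_measure_mono) auto
    also have "\<dots> \<le> \<delta>"
    proof (rule prob_linear_form_subset[where B = A'])
      show "measure_pmf.prob (Pi_pmf A' d \<mu>) {X. (\<Sum>z\<in>A'. F (fst z) * X z) = x} \<le> \<delta>" for x
        using j cardA' by (intro anti) (auto simp: A'_def)
    qed (use delta in \<open>auto simp: A'_def\<close>)
    finally show ?thesis .
  qed
qed (use delta j in auto)

section \<open>Limits and assembly of the bounds\<close>

lemma sum_reversed_powers_le:
  fixes q :: real
  assumes "0 < q" "q < 1"
  shows "(\<Sum>j<m. q ^ (m - j)) \<le> q / (1 - q)"
proof (induction m)
  case 0
  show ?case using assms by simp
next
  case (Suc m)
  have "(\<Sum>j<Suc m. q ^ (Suc m - j)) = q * (\<Sum>j<m. q ^ (m - j)) + q"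
    by (simp add: sum_distrib_left Suc_diff_le)
  also have "\<dots> \<le> q * (q / (1 - q)) + q"
    using Suc assms by (intro add_right_mono mult_left_mono) auto
  also have "\<dots> = q / (1 - q)" using assms by (simp add: field_simps)
  finally show ?case .
qed

lemma power_times_geometric_tendsto_0:
  fixes q :: real
  assumes "0 < q" "q < 1" "0 < k"
  shows "(\<lambda>n. real n ^ k * q ^ n) \<longlonglongrightarrow> 0"
proof -
  \<comment> \<open>\<open>n ^ k * q ^ n\<close> is the \<open>k\<close>-th power of
    \<open>n * r ^ n\<close>.\<close>
  define r where "r = root k q"
  have r: "0 < r" "r < 1" "r ^ k = q" using assms by (auto simp: r_def)
  have "(\<lambda>n. real n * r ^ n) \<longlonglongrightarrow> 0"
    using r powser_times_n_limit_0[of r] by simp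
  then have "(\<lambda>n. (real n * r ^ n) ^ k) \<longlonglongrightarrow> 0 ^ k" by (rule tendsto_power)
  moreover have "(real n * r ^ n) ^ k = real n ^ k * q ^ n" for n
    by (simp add: power_mult_distrib r(3)[symmetric] power_mult[symmetric] mult.commute)
  ultimately show ?thesis using assms(3) by (simp add: zero_power)
qed

text \<open>Early columns, sparse relations and late columns each get \<eta>/3. The constants are
  chosen in the order \<open>L\<close>, \<delta>, \<open>s\<close>, \<open>n\<close>: the number
  \<open>L\<close> of late columns is fixed before \<delta>, and \<open>L\<close> and
  \<open>s\<close> are fixed before \<open>n\<close> grows. The threshold for \<open>n\<close> is
  uniform in the laws, since these may change with \<open>n\<close>.\<close>

lemma (in uniformized_prime) prob_column_failure_lt:
  fixes \<epsilon> :: "'a set \<Rightarrow> real" and u :: nat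
  assumes res: "finite_residues TYPE('a)" and eps: "\<forall>I\<in>Ical. \<epsilon> I > 0" and eta: "0 < \<eta>"
  shows "\<exists>n0. \<forall>n\<ge>n0. \<forall>\<mu>. (\<forall>i<n. \<forall>j<n + u. eps_balanced \<epsilon> (\<mu> i j)) \<longrightarrow>
    measure_pmf.prob (matrix_law n u \<mu>) (\<Union>j<n. column_failure n j) < \<eta>"
proof -
  obtain e where e: "0 < e" "e < 1" "\<And>\<nu>. eps_balanced \<epsilon> \<nu> \<Longrightarrow> quot_balanced p e \<nu>"
    using quot_balanced_pow[OF res eps, of 1] unfolding pow_one by auto
  define q where "q = 1 - e"
  have q: "0 < q" "q < 1" using e by (auto simp: q_def)
  \<comment> \<open>The early failures sum to at most \<open>q ^ L\<close> times the geometric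
    series \<open>q / (1 - q)\<close>.\<close>
  obtain L where "q ^ L < \<eta> / 3 * ((1 - q) / q)"
    using real_arch_pow_inv[of "\<eta> / 3 * ((1 - q) / q)" q] eta q by auto
  then have L: "q ^ L * (q / (1 - q)) < \<eta> / 3" using q by (simp add: field_simps)
  \<comment> \<open>Each of the \<open>L\<close> late columns may fail with probability \<delta>;
    the added 1 avoids division by zero and makes the total strictly less than \<eta>/3.\<close>
  define \<delta> where "\<delta> = \<eta> / (3 * (real L + 1))"
  have delta: "0 < \<delta>" using eta by (simp add: \<delta>_def)
  have L_delta: "real L * \<delta> < \<eta> / 3" using eta by (simp add: \<delta>_def field_simps)
  from anticoncentration[OF res eps delta] obtain s where
    s: "\<forall>A (a :: nat \<times> nat \<Rightarrow> 'a) \<mu> d x. finite A \<and> s \<le> card A \<and>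
      (\<forall>i\<in>A. a i \<noteq> 0 \<and> eps_balanced \<epsilon> (\<mu> i)) \<longrightarrow>
    measure_pmf.prob (Pi_pmf A d \<mu>) {X. (\<Sum>i\<in>A. a i * X i) = x} \<le> \<delta>" ..
  have "(\<lambda>n. real (Suc s) / q ^ (L + s) * (real n ^ Suc s * q ^ n)) \<longlonglongrightarrow> real (Suc s) / q ^ (L + s) * 0"
    using q by (intro tendsto_mult_left power_times_geometric_tendsto_0) auto
  then have "eventually (\<lambda>n. real (Suc s) / q ^ (L + s) * (real n ^ Suc s * q ^ n) < \<eta> / 3) sequentially"
    using eta by (intro order_tendstoD(2)) auto
  then obtain n1 where n1: "\<And>n. n \<ge> n1 \<Longrightarrow> real (Suc s) / q ^ (L + s) * (real n ^ Suc s * q ^ n) < \<eta> / 3"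
    unfolding eventually_sequentially by blast
  have "measure_pmf.prob (matrix_law n u \<mu>) (\<Union>j<n. column_failure n j) < \<eta>"
    if n: "max n1 (Suc (L + s)) \<le> n" and bal: "\<forall>i<n. \<forall>j<n + u. eps_balanced \<epsilon> (\<mu> i j)" for n \<mu>
  proof -
    define \<mu>' where "\<mu>' = (\<lambda>(i, j). \<mu> i j)"
    let ?S = "{..<n} \<times> {..<n + u}"
    let ?law = "Pi_pmf ?S 0 \<mu>'"
    \<comment> \<open>Since \<open>n\<close> exceeds \<open>L + s\<close>, neither
      \<open>n - L\<close> nor \<open>k - s\<close> is truncated.\<close>
    define k where "k = n - L"
    have k: "n = k + L" "s \<le> k" "0 < n" using n by (auto simp: k_def)
    have atoms: "pmf (\<mu>' z) x \<le> q" if "z \<in> ?S" for z x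
      using that bal e(3) atom_le[of e "\<mu>' z" x] by (auto simp: \<mu>'_def q_def)
    have early: "(\<Sum>j<k. measure_pmf.prob ?law (column_failure n j)) < \<eta> / 3"
    proof -
      have "(\<Sum>j<k. measure_pmf.prob ?law (column_failure n j)) \<le> (\<Sum>j<k. q ^ (n - j))"
        using q k atoms by (intro sum_mono prob_column_failure_le) auto
      also have "\<dots> = q ^ L * (\<Sum>j<k. q ^ (k - j))"
        unfolding sum_distrib_left using k(1) by (intro sum.cong) (auto simp: add.commute simp flip: power_add)
      also have "\<dots> \<le> q ^ L * (q / (1 - q))"
        using q by (intro mult_left_mono sum_reversed_powers_le) auto
      finally show ?thesis using L by (rule le_less_trans)
    qed
    have sparse: "measure_pmf.prob ?law (sparse_relation n k s) < \<eta> / 3"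
    proof -
      have "measure_pmf.prob ?law (sparse_relation n k s) \<le> real (Suc s) * real n ^ Suc s * q ^ (k - s)"
        using q k(1,3) atoms by (intro prob_sparse_relation_le) auto
      also have "q ^ (k - s) = q ^ n / q ^ (L + s)"
      proof -
        have "n = (k - s) + (L + s)" using k by simp
        then have "q ^ n = q ^ (k - s) * q ^ (L + s)" by (metis power_add)
        then show ?thesis using q by simp
      qed
      also have "real (Suc s) * real n ^ Suc s * (q ^ n / q ^ (L + s))
        = real (Suc s) / q ^ (L + s) * (real n ^ Suc s * q ^ n)" by simp
      also have "\<dots> < \<eta> / 3" using n by (intro n1) simp
      finally show ?thesis .
    qed
    have late: "(\<Sum>j\<in>{k..<n}. measure_pmf.prob ?law (column_failure n j - sparse_relation n k s)) < \<eta> / 3"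
    proof -
      have "(\<Sum>j\<in>{k..<n}. measure_pmf.prob ?law (column_failure n j - sparse_relation n k s))
        \<le> (\<Sum>j\<in>{k..<n}. \<delta>)"
      proof (intro sum_mono prob_column_failure_dense_le)
        fix A :: "(nat \<times> nat) set" and a :: "nat \<times> nat \<Rightarrow> 'a" and x
        assume A: "A \<subseteq> ?S" "s \<le> card A" "\<And>z. z \<in> A \<Longrightarrow> a z \<noteq> 0"
        have "finite A" using A(1) by (rule finite_subset) simp
        moreover have "eps_balanced \<epsilon> (\<mu>' z)" if "z \<in> A" for z
          using that A(1) bal by (auto simp: \<mu>'_def)
        ultimately show "measure_pmf.prob (Pi_pmf A 0 \<mu>') {X. (\<Sum>z\<in>A. a z * X z) = x} \<le> \<delta>"
          using A(2,3) by (intro s[rule_format]) auto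
      qed (use delta in auto)
      also have "\<dots> = real L * \<delta>" using k(1) by simp
      finally show ?thesis using L_delta by simp
    qed
    have "measure_pmf.prob ?law (\<Union>j<n. column_failure n j)
      \<le> measure_pmf.prob ?law ((\<Union>j<k. column_failure n j) \<union> (sparse_relation n k s \<union>
          (\<Union>j\<in>{k..<n}. column_failure n j - sparse_relation n k s)))"
    proof (intro measure_pmf.finite_measure_mono)
      have "{..<n} = {..<k} \<union> {k..<n}" using k(1) by auto
      then show "(\<Union>j<n. column_failure n j) \<subseteq> (\<Union>j<k. column_failure n j) \<union>
          (sparse_relation n k s \<union> (\<Union>j\<in>{k..<n}. column_failure n j - sparse_relation n k s))"
        by blast
    qed simp
    also have "\<dots> \<le> measure_pmf.prob ?law (\<Union>j<k. column_failure n j)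
      + (measure_pmf.prob ?law (sparse_relation n k s)
      + measure_pmf.prob ?law (\<Union>j\<in>{k..<n}. column_failure n j - sparse_relation n k s))"
      by (intro order_trans[OF measure_Un_le] add_left_mono measure_Un_le) auto
    also have "\<dots> \<le> (\<Sum>j<k. measure_pmf.prob ?law (column_failure n j))
      + (measure_pmf.prob ?law (sparse_relation n k s)
      + (\<Sum>j\<in>{k..<n}. measure_pmf.prob ?law (column_failure n j - sparse_relation n k s)))"
      by (intro add_mono order_refl measure_pmf.finite_measure_subadditive_finite) auto
    also have "\<dots> < \<eta>" using early sparse late by linarith
    finally show ?thesis unfolding matrix_law_def \<mu>'_def .
  qed
  then show ?thesis by blast
qed

theorem theorem3p3:
  fixes \<epsilon> :: "'a::idom set \<Rightarrow> real"
    and P :: "'a set set"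
    and u :: nat
    and \<mu> :: "nat \<Rightarrow> nat \<Rightarrow> nat \<Rightarrow> 'a pmf"
  assumes "countable (UNIV :: 'a set)"
    and "dedekind_domain TYPE('a)"
    and "finite_residues TYPE('a)"
    and "\<forall>I\<in>Ical. \<epsilon> I > 0"
    and "finite P"
    and "\<forall>p\<in>P. is_prime_ideal p \<and> p \<noteq> {0}"
    and "u > 0"
    and "\<forall>n. \<forall>i<n. \<forall>j<n + u. eps_balanced \<epsilon> (\<mu> n i j)"
  shows "(\<lambda>n. measure_pmf.prob (matrix_law n u (\<mu> n)) {M. finite (cok_tensor P n u M)})
           \<longlonglongrightarrow> 1"
proof (cases "P = {}")
  \<comment> \<open>The empty product is the zero ring, so a single class remains; there is no prime
    at which to localize.\<close>
  case True
  have "finite (cok_tensor P n u M)" for n M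
  proof -
    have "Avec P n \<subseteq> {\<lambda>r p m. 0}" using True by (auto simp: Avec_iff fun_eq_iff)
    then have "finite (Avec P n)" by (rule finite_subset) simp
    then show ?thesis by (simp add: cok_tensor_def quotient_def)
  qed
  then show ?thesis by simp
next
  case False
  have uni: "\<exists>w t. uniformized_prime p w t" if "p \<in> P" for p
    using exists_uniformized_prime assms(2,6) that by blast
  \<comment> \<open>Any prime of \<open>P\<close> will do: it serves to bound the failure
    probability, and success gives finiteness at all primes of \<open>P\<close> at once.\<close>
  from False obtain p where "p \<in> P" by blast
  then obtain w t where "uniformized_prime p w t" using uni by blast
  then interpret uniformized_prime p w t .
  have good: "- (\<Union>j<n. column_failure n j) \<subseteq> {M. finite (cok_tensor P n u M)}" for n
  proof
    fix M :: "nat \<times> nat \<Rightarrow> 'a" assume M: "M \<in> - (\<Union>j<n. column_failure n j)"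
    have "\<exists>D N. D \<noteq> 0 \<and>
        (\<forall>r<n. \<forall>r'<n. (\<Sum>c<n + u. M (r, c) * N c r') = (if r = r' then D else 0))"
      by (rule exists_scalar_right_inverse) (use M in \<open>auto simp: column_failure_def\<close>)
    then show "M \<in> {M. finite (cok_tensor P n u M)}"
      using finite_cok_tensor[OF assms(3,5) uni] by blast
  qed
  show ?thesis
  proof (rule LIMSEQ_I)
    fix \<eta> :: real assume "0 < \<eta>"
    from prob_column_failure_lt[OF assms(3,4) this, of u] obtain n0 where
      n0: "\<forall>n\<ge>n0. \<forall>\<mu>. (\<forall>i<n. \<forall>j<n + u. eps_balanced \<epsilon> (\<mu> i j)) \<longrightarrow>
        measure_pmf.prob (matrix_law n u \<mu>) (\<Union>j<n. column_failure n j) < \<eta>" ..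
    have "norm (measure_pmf.prob (matrix_law n u (\<mu> n)) {M. finite (cok_tensor P n u M)} - 1) < \<eta>"
      if "n0 \<le> n" for n
    proof -
      let ?law = "matrix_law n u (\<mu> n)"
      have "1 - measure_pmf.prob ?law (\<Union>j<n. column_failure n j)
        = measure_pmf.prob ?law (- (\<Union>j<n. column_failure n j))"
        using measure_pmf.prob_compl[of "\<Union>j<n. column_failure n j" ?law] by (simp add: Compl_eq_Diff_UNIV)
      also have "\<dots> \<le> measure_pmf.prob ?law {M. finite (cok_tensor P n u M)}"
        using good by (intro measure_pmf.finite_measure_mono) auto
      finally have "1 - \<eta> < measure_pmf.prob ?law {M. finite (cok_tensor P n u M)}"
        using n0 that assms(8) by (smt (verit, best))
      moreover have "measure_pmf.prob ?law {M. finite (cok_tensor P n u M)} \<le> 1" by simp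
      ultimately show ?thesis by simp
    qed
    then show "\<exists>no. \<forall>n\<ge>no. norm (measure_pmf.prob (matrix_law n u (\<mu> n))
        {M. finite (cok_tensor P n u M)} - 1) < \<eta>" by blast
  qed
qed

end
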